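(* Let $\lambda\in\mathbb{P}^1=\mathbb{C}\cup\{\infty\}$. Then $$\mathrm{Der}(\mathcal{W}_A(\lambda))=\mathrm{Inn}(\mathcal{W}_A(\lambda))\oplus\mathbb{C}d_{\mathrm{Ab}}\oplus\mathbb{C}d_\lambda^A,$$ $$\mathrm{Der}(\mathcal{W}_B(\lambda))=\begin{cases}\mathrm{Inn}(\mathcal{W}_B(\lambda))\oplus\mathbb{C}d_{\mathrm{Ab}}\oplus\mathbb{C}d_0^B\oplus\mathbb{C}\partial_0^B,&\text{if }\lambda=0,\\ \mathrm{Inn}(\mathcal{W}_B(\lambda))\oplus\mathbb{C}d_{\mathrm{Ab}}\oplus\mathbb{C}d_\lambda^B,&\text{if }\lambda\neq0.\end{cases}$$ Consequently, $$\dim H^1(\mathcal{W}_A(\lambda);\mathcal{W}_A(\lambda))=2,\qquad \dim H^1(\mathcal{W}_B(\lambda);\mathcal{W}_B(\lambda))=\begin{cases}3,&\text{if }\lambda=0,\\2,&\text{if }\lambda\ne0.\end{cases}$$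
   Context: All vector spaces are over $\mathbb{C}$. $\delta_n^0$ equals $1$ if $n=0$ and $0$ otherwise. $\mathcal{W}$ is the Witt algebra, with basis $\{L_n\}_{n\in\mathbb{Z}}$ and bracket $[L_n,L_m]=(m-n)L_{n+m}$. For $\lambda\in\mathbb{P}^1=\mathbb{C}\cup\{\infty\}$, $A(\lambda)$ and $B(\lambda)$ are the $\mathcal{W}$-modules with bases $\{A_n\}_{n\in\mathbb{Z}}$, $\{B_n\}_{n\in\mathbb{Z}}$ and actions $$L_n\cdot A_m=(n+m+n(n+1)\lambda\delta_m^0)A_{n+m},\qquad L_n\cdot B_m=(m-n(n+1)\lambda\delta_{n+m}^0)B_{n+m},$$ where for $\lambda=\infty$ the expression $n(n+1)\lambda$ is replaced by $n^2$. For $X\in\{A,B\}$, $\mathcal{W}_X(\lambda)=\mathcal{W}\ltimes X(\lambda)$ is the semi-direct sum in which $X(\lambda)$ is an abelian ideal and $[L_n,X_m]=L_n\cdot X_m$. $\mathrm{Der}(\mathfrak{g})$ is the space of derivations $\mathfrak{g}\to\mathfrak{g}$, $\mathrm{Inn}(\mathfrak{g})$ the subspace of inner derivations, and $H^1(\mathfrak{g};\mathfrak{g})\cong\mathrm{Der}(\mathfrak{g})/\mathrm{Inn}(\mathfrak{g})$. The derivations are given by, for all $n\in\mathbb{Z}$: - $d_{\mathrm{Ab}}(L_n)=0$, $d_{\mathrm{Ab}}(X_n)=X_n$ (for $X=A$ and $X=B$); - $d_\lambda^A(A_n)=0$, and $d_\lambda^A(L_n)=nA_n$ if $\lambda\neq0$,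 $d_0^A(L_n)=n(n+1)A_n$ if $\lambda=0$; - $d_\lambda^B(B_n)=0$, and $d_\lambda^B(L_n)=(\lambda+1)B_0$ if $n=0$ and $\lambda\ne\infty$, $d_\lambda^B(L_n)=B_n$ otherwise; - $\partial_0^B(L_n)=nB_n$, $\partial_0^B(B_n)=0$ (a derivation of $\mathcal{W}_B(0)$). *)

theory Defs
  imports
    Jordan_Normal_Form.VS_Connect
    "HOL-Library.Poly_Mapping"
    "HOL-Library.Function_Algebras"
    "HOL-Library.Product_Plus"
begin

section \<open>Quotients, direct sums and dimension\<close>

text \<open>The quotient \<open>Z / B\<close> has the cosets \<open>v + B\<close> as elements. Its dimension is
  measured with the carrier-based vector spaces of the entry VectorSpace, since
  \<open>Z / B\<close> is in general not the universe of a type. The fields \<open>mult\<close> and \<open>one\<close>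
  of the record play no role for modules.\<close>

definition quotient_space ::
  "('f \<Rightarrow> 'v \<Rightarrow> 'v::ab_group_add) \<Rightarrow> 'v set \<Rightarrow> 'v set \<Rightarrow> ('f, 'v set) module" where
  "quotient_space scale Z B =
     \<lparr> carrier = {{v + b | b. b \<in> B} | v. v \<in> Z},
       mult = undefined, one = undefined,
       zero = B, add = (\<lambda>X Y. {x + y | x y. x \<in> X \<and> y \<in> Y}),
       smult = (\<lambda>c X. {scale c x + b | x b. x \<in> X \<and> b \<in> B}) \<rparr>"

text \<open>The constant \<open>vectorspace.dim\<close> is only meaningful for finite-dimensional spaces.\<close>

definition has_dimension :: "('f::field, 'v) module \<Rightarrow> nat \<Rightarrow> bool" where
  "has_dimension V n \<longleftrightarrow>
     vectorspace class_ring V \<and> vectorspace.fin_dim class_ring V \<and>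
     vectorspace.dim class_ring V = n"

text \<open>\<open>V\<close> is the internal direct sum of the subspaces in the list \<open>Us\<close>: every element of
  \<open>V\<close> is the sum of exactly one choice of an element from each of them.\<close>

definition is_direct_sum ::
  "('f::field \<Rightarrow> 'v \<Rightarrow> 'v::ab_group_add) \<Rightarrow> 'v set \<Rightarrow> 'v set list \<Rightarrow> bool" where
  "is_direct_sum scale V Us \<longleftrightarrow>
     (\<forall>U\<in>set Us. module.subspace scale U) \<and> bij_betw sum_list (listset Us) V"

definition line :: "('f \<Rightarrow> 'v \<Rightarrow> 'v) \<Rightarrow> 'v \<Rightarrow> 'v set" where
  "line scale v = {scale c v | c. True}"

definition fun_scale :: "('f \<Rightarrow> 'v \<Rightarrow> 'v) \<Rightarrow> 'f \<Rightarrow> ('u \<Rightarrow> 'v) \<Rightarrow> ('u \<Rightarrow> 'v)" where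
  "fun_scale scale c f = (\<lambda>x. scale c (f x))"


section \<open>Lie algebras, derivations and first cohomology\<close>

locale lie_algebra = vector_space scale
  for scale :: "'f::field \<Rightarrow> 'g::ab_group_add \<Rightarrow> 'g" +
  fixes bracket :: "'g \<Rightarrow> 'g \<Rightarrow> 'g"
  assumes bracket_linear_left: "Vector_Spaces.linear scale scale (\<lambda>x. bracket x y)"
    and bracket_linear_right: "Vector_Spaces.linear scale scale (bracket x)"
    and bracket_self: "bracket x x = 0"
    and jacobi: "bracket x (bracket y z) + bracket y (bracket z x) + bracket z (bracket x y) = 0"
begin

definition Der :: "('g \<Rightarrow> 'g) set" where
  "Der = {D. Vector_Spaces.linear scale scale D \<and>
             (\<forall>x y. D (bracket x y) = bracket (D x) y + bracket x (D y))}"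

definition Inn :: "('g \<Rightarrow> 'g) set" where
  "Inn = {bracket x | x. True}"

text \<open>Chevalley--Eilenberg cochains with adjoint coefficients in degrees 0 and 1. The
  kernel of \<open>d1\<close> is \<open>Der\<close> and the image of \<open>d0\<close> is \<open>Inn\<close>.\<close>

definition d0 :: "'g \<Rightarrow> 'g \<Rightarrow> 'g" where
  "d0 x = (\<lambda>y. bracket y x)"

definition d1 :: "('g \<Rightarrow> 'g) \<Rightarrow> 'g \<Rightarrow> 'g \<Rightarrow> 'g" where
  "d1 f = (\<lambda>x y. bracket x (f y) - bracket y (f x) - f (bracket x y))"

definition H1 :: "('f, ('g \<Rightarrow> 'g) set) module" where
  "H1 = quotient_space (fun_scale scale)
          {f. Vector_Spaces.linear scale scale f \<and> d1 f = (\<lambda>x y. 0)} (range d0)"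

lemma bracket_add_left: "bracket (x + y) z = bracket x z + bracket y z"
  and bracket_scale_left: "bracket (scale c x) z = scale c (bracket x z)"
  and bracket_add_right: "bracket z (x + y) = bracket z x + bracket z y"
  and bracket_scale_right: "bracket z (scale c x) = scale c (bracket z x)"
  using bracket_linear_left bracket_linear_right
  unfolding Vector_Spaces.linear_def module_hom_def module_hom_axioms_def by auto

lemma bracket_swap: "bracket x y = - bracket y x"
proof -
  have "bracket x x + bracket x y + (bracket y x + bracket y y) = 0"
    using bracket_self[of "x + y"] unfolding bracket_add_left bracket_add_right
    by (simp only: ac_simps)
  then have "bracket x y + bracket y x = 0" by (simp add: bracket_self)
  then show ?thesis by (simp only: eq_neg_iff_add_eq_0)
qed

lemma cocycles_eq_Der:
  "{f. Vector_Spaces.linear scale scale f \<and> d1 f = (\<lambda>x y. 0)} = Der"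
proof -
  have "(d1 f = (\<lambda>x y. 0)) \<longleftrightarrow> (\<forall>x y. f (bracket x y) = bracket (f x) y + bracket x (f y))" for f
  proof -
    have "d1 f x y = bracket x (f y) + bracket (f x) y - f (bracket x y)" for x y
      using bracket_swap[of y "f x"] by (simp add: d1_def)
    then show ?thesis
      by (metis (no_types, lifting) add.commute eq_iff_diff_eq_0 ext)
  qed
  then show ?thesis unfolding Der_def by auto
qed

lemma coboundaries_eq_Inn: "range d0 = Inn"
proof -
  have d0: "d0 x = bracket (- x)" for x
  proof
    fix y
    have "bracket (- x) y + bracket x y = 0"
      using bracket_add_left[of "- x" x y] bracket_add_left[of 0 0 y] by simp
    then have "bracket (- x) y = - bracket x y" by (simp only: eq_neg_iff_add_eq_0)
    then show "d0 x y = bracket (- x) y"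
      using bracket_swap[of y x] by (simp add: d0_def)
  qed
  have "bracket x \<in> range d0" for x
    using d0[of "- x"] by (metis minus_minus rangeI)
  then show ?thesis unfolding Inn_def using d0 by auto
qed

end

locale lie_module = lie_algebra scale bracket + M: vector_space scaleM
  for scale :: "'f::field \<Rightarrow> 'g::ab_group_add \<Rightarrow> 'g" and bracket
    and scaleM :: "'f \<Rightarrow> 'm::ab_group_add \<Rightarrow> 'm" +
  fixes act :: "'g \<Rightarrow> 'm \<Rightarrow> 'm"
  assumes act_linear_left: "Vector_Spaces.linear scale scaleM (\<lambda>x. act x m)"
    and act_linear_right: "Vector_Spaces.linear scaleM scaleM (act x)"
    and act_bracket: "act (bracket x y) m = act x (act y m) - act y (act x m)"

definition prod_scale ::
  "('f \<Rightarrow> 'g \<Rightarrow> 'g) \<Rightarrow> ('f \<Rightarrow> 'm \<Rightarrow> 'm) \<Rightarrow> 'f \<Rightarrow> 'g \<times> 'm \<Rightarrow> 'g \<times> 'm" where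
  "prod_scale s t c = map_prod (s c) (t c)"

text \<open>The bracket of the semi-direct sum, with the module as an abelian ideal.\<close>

definition semidirect_bracket ::
  "('g \<Rightarrow> 'g \<Rightarrow> 'g) \<Rightarrow> ('g \<Rightarrow> 'm \<Rightarrow> 'm::ab_group_add) \<Rightarrow> 'g \<times> 'm \<Rightarrow> 'g \<times> 'm \<Rightarrow> 'g \<times> 'm" where
  "semidirect_bracket bracket act = (\<lambda>(x, a) (y, b). (bracket x y, act x b - act y a))"

context lie_module
begin

lemma act_add_left: "act (x + y) m = act x m + act y m"
  and act_scale_left: "act (scale c x) m = scaleM c (act x m)"
  and act_add_right: "act x (m + k) = act x m + act x k"
  and act_scale_right: "act x (scaleM c m) = scaleM c (act x m)"
  using act_linear_left act_linear_right
  unfolding Vector_Spaces.linear_def module_hom_def module_hom_axioms_def by auto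

lemma act_diff_right: "act x (m - k) = act x m - act x k"
  by (metis act_add_right add_diff_cancel_right' diff_add_cancel)

lemma lie_algebra_semidirect:
  "lie_algebra (prod_scale scale scaleM) (semidirect_bracket bracket act)"
proof -
  have vs: "vector_space (prod_scale scale scaleM)"
    by unfold_locales
      (auto simp: prod_scale_def scale_right_distrib scale_left_distrib
        M.scale_right_distrib M.scale_left_distrib)
  interpret P: vector_space "prod_scale scale scaleM" by (rule vs)
  show ?thesis
  proof (unfold_locales, goal_cases)
    case (1 y a b) then show ?case
      by (cases y; cases a; cases b)
        (simp add: semidirect_bracket_def bracket_add_left act_add_left act_add_right)
  next
    case (2 y r b) then show ?case
      by (cases y; cases b)
        (simp add: semidirect_bracket_def prod_scale_def bracket_scale_left act_scale_left
          act_scale_right M.scale_right_diff_distrib)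
  next
    case (3 x b1 b2) then show ?case
      by (cases x; cases b1; cases b2)
        (simp add: semidirect_bracket_def bracket_add_right act_add_left act_add_right)
  next
    case (4 x r b) then show ?case
      by (cases x; cases b)
        (simp add: semidirect_bracket_def prod_scale_def bracket_scale_right act_scale_left
          act_scale_right M.scale_right_diff_distrib)
  next
    case (5 x) then show ?case
      by (cases x) (simp add: semidirect_bracket_def bracket_self zero_prod_def)
  next
    case (6 x y z) then show ?case
      by (cases x; cases y; cases z)
        (simp add: semidirect_bracket_def jacobi act_bracket act_diff_right zero_prod_def)
  qed
qed

end


section \<open>Graded bilinear and diagonal maps on finitely supported functions\<close>

text \<open>The vector space with basis indexed by the integers is \<open>int \<Rightarrow>\<^sub>0 complex\<close>, the
  \<open>n\<close>-th basis vector being \<open>single n 1\<close>.\<close>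

definition pm_scale :: "complex \<Rightarrow> (int \<Rightarrow>\<^sub>0 complex) \<Rightarrow> (int \<Rightarrow>\<^sub>0 complex)" where
  "pm_scale c f = Poly_Mapping.map ((*) c) f"

text \<open>The bilinear map sending the \<open>n\<close>-th and \<open>m\<close>-th basis vectors to \<open>c n m\<close> times the
  basis vector of index \<open>n + m\<close>.\<close>

definition bilinear_ext ::
  "(int \<Rightarrow> int \<Rightarrow> complex) \<Rightarrow> (int \<Rightarrow>\<^sub>0 complex) \<Rightarrow> (int \<Rightarrow>\<^sub>0 complex) \<Rightarrow> (int \<Rightarrow>\<^sub>0 complex)" where
  "bilinear_ext c f g =
     (\<Sum>n\<in>Poly_Mapping.keys f. \<Sum>m\<in>Poly_Mapping.keys g.
        Poly_Mapping.single (n + m)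
          (Poly_Mapping.lookup f n * Poly_Mapping.lookup g m * c n m))"

text \<open>The linear map sending the \<open>n\<close>-th basis vector to \<open>c n\<close> times itself.\<close>

definition diagonal_ext :: "(int \<Rightarrow> complex) \<Rightarrow> (int \<Rightarrow>\<^sub>0 complex) \<Rightarrow> (int \<Rightarrow>\<^sub>0 complex)" where
  "diagonal_ext c f =
     (\<Sum>n\<in>Poly_Mapping.keys f. Poly_Mapping.single n (Poly_Mapping.lookup f n * c n))"

lemma lookup_pm_scale [simp]:
  "Poly_Mapping.lookup (pm_scale c f) n = c * Poly_Mapping.lookup f n"
  unfolding pm_scale_def by transfer (simp add: when_def)

lemma pm_scale_single [simp]: "pm_scale c (Poly_Mapping.single n a) = Poly_Mapping.single n (c * a)"
  by (rule poly_mapping_eqI) (simp add: lookup_single when_def)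

lemma vector_space_pm_scale: "vector_space pm_scale"
  by unfold_locales (auto intro!: poly_mapping_eqI simp: lookup_add algebra_simps)

interpretation pm: vector_space pm_scale
  by (rule vector_space_pm_scale)

lemma bilinear_ext_superset:
  assumes "finite S" "finite T" "Poly_Mapping.keys f \<subseteq> S" "Poly_Mapping.keys g \<subseteq> T"
  shows "bilinear_ext c f g =
    (\<Sum>n\<in>S. \<Sum>m\<in>T. Poly_Mapping.single (n + m)
       (Poly_Mapping.lookup f n * Poly_Mapping.lookup g m * c n m))"
proof -
  have "bilinear_ext c f g =
    (\<Sum>n\<in>Poly_Mapping.keys f. \<Sum>m\<in>T. Poly_Mapping.single (n + m)
       (Poly_Mapping.lookup f n * Poly_Mapping.lookup g m * c n m))"
    unfolding bilinear_ext_def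
    by (intro sum.cong refl sum.mono_neutral_left) (use assms in \<open>auto simp: in_keys_iff\<close>)
  also have "\<dots> = (\<Sum>n\<in>S. \<Sum>m\<in>T. Poly_Mapping.single (n + m)
       (Poly_Mapping.lookup f n * Poly_Mapping.lookup g m * c n m))"
    by (intro sum.mono_neutral_left) (use assms in \<open>auto simp: in_keys_iff\<close>)
  finally show ?thesis .
qed

lemma bilinear_ext_add_left: "bilinear_ext c (f + f') g = bilinear_ext c f g + bilinear_ext c f' g"
proof -
  let ?S = "Poly_Mapping.keys f \<union> Poly_Mapping.keys f'"
  have "Poly_Mapping.keys (f + f') \<subseteq> ?S" by (rule keys_add)
  then show ?thesis
    by (subst (1 2 3) bilinear_ext_superset[where S = ?S and T = "Poly_Mapping.keys g"])
      (auto simp: lookup_add algebra_simps single_add sum.distrib)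
qed

lemma bilinear_ext_add_right: "bilinear_ext c g (f + f') = bilinear_ext c g f + bilinear_ext c g f'"
proof -
  let ?S = "Poly_Mapping.keys f \<union> Poly_Mapping.keys f'"
  have "Poly_Mapping.keys (f + f') \<subseteq> ?S" by (rule keys_add)
  then show ?thesis
    by (subst (1 2 3) bilinear_ext_superset[where T = ?S and S = "Poly_Mapping.keys g"])
      (auto simp: lookup_add algebra_simps single_add sum.distrib)
qed

lemma bilinear_ext_scale_left: "bilinear_ext c (pm_scale a f) g = pm_scale a (bilinear_ext c f g)"
proof -
  have "Poly_Mapping.keys (pm_scale a f) \<subseteq> Poly_Mapping.keys f" by (auto simp: in_keys_iff)
  then show ?thesis
    by (subst (1 2) bilinear_ext_superset[where S = "Poly_Mapping.keys f" and T = "Poly_Mapping.keys g"])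
      (auto simp: pm.scale_sum_right mult.assoc)
qed

lemma bilinear_ext_scale_right: "bilinear_ext c g (pm_scale a f) = pm_scale a (bilinear_ext c g f)"
proof -
  have "Poly_Mapping.keys (pm_scale a f) \<subseteq> Poly_Mapping.keys f" by (auto simp: in_keys_iff)
  then show ?thesis
    by (subst (1 2) bilinear_ext_superset[where T = "Poly_Mapping.keys f" and S = "Poly_Mapping.keys g"])
      (auto simp: pm.scale_sum_right mult.assoc mult.left_commute)
qed

lemma bilinear_ext_single [simp]:
  "bilinear_ext c (Poly_Mapping.single n a) (Poly_Mapping.single m b) =
     Poly_Mapping.single (n + m) (a * b * c n m)"
  by (subst bilinear_ext_superset[where S = "{n}" and T = "{m}"]) (auto simp: lookup_single)

lemma diagonal_ext_single [simp]:
  "diagonal_ext c (Poly_Mapping.single n a) = Poly_Mapping.single n (a * c n)"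
  by (cases "a = 0") (auto simp: diagonal_ext_def)

lemma pm_induct [case_names zero single add]:
  assumes "P 0" "\<And>n a. P (Poly_Mapping.single n a)" "\<And>f g. P f \<Longrightarrow> P g \<Longrightarrow> P (f + g)"
  shows "P (f :: int \<Rightarrow>\<^sub>0 complex)"
proof -
  have *: "f = (\<Sum>n\<in>Poly_Mapping.keys f. Poly_Mapping.single n (Poly_Mapping.lookup f n))"
    by (rule poly_mapping_eqI)
      (auto simp: lookup_sum lookup_single when_def in_keys_iff sum.delta)
  have "P (\<Sum>n\<in>S. Poly_Mapping.single n (Poly_Mapping.lookup f n))" if "finite S" for S
    using that by induction (auto intro: assms)
  then show ?thesis using * by (metis finite_keys)
qed


section \<open>The Witt algebra and the modules A and B\<close>

definition witt_bracket :: "(int \<Rightarrow>\<^sub>0 complex) \<Rightarrow> (int \<Rightarrow>\<^sub>0 complex) \<Rightarrow> (int \<Rightarrow>\<^sub>0 complex)" where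
  "witt_bracket = bilinear_ext (\<lambda>n m. of_int (m - n))"

datatype proj_line = Finite complex | Infinity

text \<open>The expression \<open>n (n + 1) \<lambda>\<close>, read as \<open>n\<^sup>2\<close> at infinity.\<close>

fun lam_term :: "proj_line \<Rightarrow> int \<Rightarrow> complex" where
  "lam_term (Finite l) n = of_int (n * (n + 1)) * l"
| "lam_term Infinity n = of_int (n ^ 2)"

definition act_A :: "proj_line \<Rightarrow> (int \<Rightarrow>\<^sub>0 complex) \<Rightarrow> (int \<Rightarrow>\<^sub>0 complex) \<Rightarrow> (int \<Rightarrow>\<^sub>0 complex)" where
  "act_A lam = bilinear_ext (\<lambda>n m. of_int (n + m) + lam_term lam n * of_bool (m = 0))"

definition act_B :: "proj_line \<Rightarrow> (int \<Rightarrow>\<^sub>0 complex) \<Rightarrow> (int \<Rightarrow>\<^sub>0 complex) \<Rightarrow> (int \<Rightarrow>\<^sub>0 complex)" where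
  "act_B lam = bilinear_ext (\<lambda>n m. of_int m - lam_term lam n * of_bool (n + m = 0))"

text \<open>Elements of the semi-direct sums are pairs of an element of the Witt algebra and an
  element of the module.\<close>

type_synonym witt_ext = "(int \<Rightarrow>\<^sub>0 complex) \<times> (int \<Rightarrow>\<^sub>0 complex)"

definition wscale :: "complex \<Rightarrow> witt_ext \<Rightarrow> witt_ext" where
  "wscale = prod_scale pm_scale pm_scale"

definition WA_bracket :: "proj_line \<Rightarrow> witt_ext \<Rightarrow> witt_ext \<Rightarrow> witt_ext" where
  "WA_bracket lam = semidirect_bracket witt_bracket (act_A lam)"

definition WB_bracket :: "proj_line \<Rightarrow> witt_ext \<Rightarrow> witt_ext \<Rightarrow> witt_ext" where
  "WB_bracket lam = semidirect_bracket witt_bracket (act_B lam)"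

lemmas bilinear_ext_simps =
  bilinear_ext_add_left bilinear_ext_add_right bilinear_ext_scale_left bilinear_ext_scale_right

lemma bilinear_ext_zero [simp]: "bilinear_ext c 0 g = 0" "bilinear_ext c f 0 = 0"
  by (simp_all add: bilinear_ext_def)

lemma witt_bracket_add [simp]:
  "witt_bracket (x + y) z = witt_bracket x z + witt_bracket y z"
  "witt_bracket z (x + y) = witt_bracket z x + witt_bracket z y"
  "witt_bracket 0 x = 0" "witt_bracket x 0 = 0"
  by (simp_all add: witt_bracket_def bilinear_ext_simps)

lemma witt_jacobi:
  "witt_bracket x (witt_bracket y z) + witt_bracket y (witt_bracket z x)
     + witt_bracket z (witt_bracket x y) = 0" (is "?J x y z = 0")
proof -
  have J_add: "?J (x + x') y z = ?J x y z + ?J x' y z" "?J x (y + y') z = ?J x y z + ?J x y' z"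
    "?J x y (z + z') = ?J x y z + ?J x y z'" for x x' y y' z z'
    by (simp_all only: witt_bracket_add ac_simps)
  show ?thesis
  proof (induction x rule: pm_induct)
    case (single n a)
    show ?case
    proof (induction y rule: pm_induct)
      case (single m b)
      show ?case
      proof (induction z rule: pm_induct)
        case (single k c)
        show ?case
          by (simp add: witt_bracket_def ac_simps flip: single_add) (simp add: algebra_simps)
      next
        case (add f g) then show ?case by (simp only: add_0 J_add)
      qed simp
    next
      case (add f g) then show ?case by (simp only: add_0 J_add)
    qed simp
  next
    case (add f g) then show ?case by (simp only: add_0 J_add)
  qed simp
qed

lemma witt_alternating: "witt_bracket x x = 0"
proof -
  have J_add: "witt_bracket (x + x') y + witt_bracket y (x + x') =
      (witt_bracket x y + witt_bracket y x) + (witt_bracket x' y + witt_bracket y x')" for x x' y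
    by (simp only: witt_bracket_add ac_simps)
  have swap: "witt_bracket x y + witt_bracket y x = 0" for x y
  proof (induction x rule: pm_induct)
    case (single n a)
    show ?case
    proof (induction y rule: pm_induct)
      case (single m b)
      show ?case
        by (simp add: witt_bracket_def add.commute flip: single_add) (simp add: algebra_simps)
    next
      case (add f g) then show ?case
        using J_add[of f g "Poly_Mapping.single n a"] by (simp only: add_0 add.commute)
    qed simp
  next
    case (add f g) then show ?case
      by (simp only: J_add add_0)
  qed simp
  have "Poly_Mapping.lookup (witt_bracket x x) n = 0" for n
    using arg_cong[OF swap[of x x], of "\<lambda>f. Poly_Mapping.lookup f n"]
    by (simp only: lookup_add lookup_zero) simp
  then show ?thesis by (intro poly_mapping_eqI) simp
qed

interpretation witt: lie_algebra pm_scale witt_bracket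
  by unfold_locales
    (simp_all add: witt_jacobi witt_alternating, simp_all add: witt_bracket_def bilinear_ext_simps)

lemma lie_module_bilinear_ext:
  assumes "\<And>n k m. of_int (k - n) * c (n + k) m = c k m * c n (k + m) - c n m * c k (n + m)"
  shows "lie_module pm_scale witt_bracket pm_scale (bilinear_ext c)"
proof -
  let ?D = "\<lambda>x y m. bilinear_ext c x (bilinear_ext c y m) - bilinear_ext c y (bilinear_ext c x m)"
  have act: "bilinear_ext c (witt_bracket x y) m = ?D x y m" for x y m
  proof (induction x rule: pm_induct)
    case (single n a)
    show ?case
    proof (induction y rule: pm_induct)
      case (single k b)
      show ?case
      proof (induction m rule: pm_induct)
        case (single m d)
        have "a * b * of_int (k - n) * d * c (n + k) m = a * b * d * (of_int (k - n) * c (n + k) m)"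
          by (simp only: mult_ac)
        also have "\<dots> = b * d * c k m * a * c n (k + m) - a * d * c n m * b * c k (n + m)"
          unfolding assms by (simp add: algebra_simps)
        finally show ?case
          by (simp add: witt_bracket_def add.commute add.left_commute mult_ac flip: single_diff)
      next
        case (add f g) then show ?case by (simp only: bilinear_ext_simps add_diff_add)
      qed simp
    next
      case (add f g) then show ?case by (simp only: witt_bracket_add bilinear_ext_simps add_diff_add)
    qed simp
  next
    case (add f g) then show ?case by (simp only: witt_bracket_add bilinear_ext_simps add_diff_add)
  qed simp
  show ?thesis
    by unfold_locales (simp_all add: bilinear_ext_simps act)
qed

lemma lie_module_act_A: "lie_module pm_scale witt_bracket pm_scale (act_A lam)"
  unfolding act_A_def
proof (rule lie_module_bilinear_ext, goal_cases)
  case (1 n k m)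
  show ?case
    by (cases lam; cases "m = 0"; cases "k + m = 0"; cases "n + m = 0")
      (simp_all add: algebra_simps power2_eq_square eq_neg_iff_add_eq_0[symmetric])
qed

lemma lie_module_act_B: "lie_module pm_scale witt_bracket pm_scale (act_B lam)"
  unfolding act_B_def
proof (rule lie_module_bilinear_ext, goal_cases)
  case (1 n k m)
  show ?case
  proof (cases "n + k + m = 0")
    case True
    then have m: "m = - n - k" by simp
    show ?thesis unfolding m
      by (cases lam; cases "n = 0"; cases "k = 0") (simp_all add: algebra_simps power2_eq_square)
  next
    case False
    then have ne: "n + k + m \<noteq> 0" "k + (n + m) \<noteq> 0" "n + (k + m) \<noteq> 0" by simp_all
    show ?thesis
    proof (cases "k = n")
      case True then show ?thesis by simp
    next
      case distinct: False
      consider "k = - m" "n + m \<noteq> 0" | "n = - m" "k + m \<noteq> 0" | "k + m \<noteq> 0" "n + m \<noteq> 0"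
        using distinct by linarith
      then show ?thesis
      proof cases
        case 1 show ?thesis using ne 1(2) unfolding 1(1) by (auto simp: algebra_simps)
      next
        case 2 show ?thesis using ne 2(2) unfolding 2(1) by (auto simp: algebra_simps)
      next
        case 3 then show ?thesis using ne by (simp add: algebra_simps)
      qed
    qed
  qed
qed

interpretation WA: lie_algebra wscale "WA_bracket lam" for lam
  unfolding wscale_def WA_bracket_def
  by (intro lie_module.lie_algebra_semidirect lie_module_act_A)

interpretation WB: lie_algebra wscale "WB_bracket lam" for lam
  unfolding wscale_def WB_bracket_def
  by (intro lie_module.lie_algebra_semidirect lie_module_act_B)


section \<open>The outer derivations\<close>

definition d_Ab :: "witt_ext \<Rightarrow> witt_ext" where
  "d_Ab = (\<lambda>(x, a). (0, a))"

definition d_A :: "proj_line \<Rightarrow> witt_ext \<Rightarrow> witt_ext" where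
  "d_A lam = (\<lambda>(x, a). (0, diagonal_ext
     (\<lambda>n. if lam = Finite 0 then of_int (n * (n + 1)) else of_int n) x))"

definition d_B :: "proj_line \<Rightarrow> witt_ext \<Rightarrow> witt_ext" where
  "d_B lam = (\<lambda>(x, b). (0, diagonal_ext
     (\<lambda>n. case lam of Finite l \<Rightarrow> if n = 0 then l + 1 else 1 | Infinity \<Rightarrow> 1) x))"

definition del_B :: "witt_ext \<Rightarrow> witt_ext" where
  "del_B = (\<lambda>(x, b). (0, diagonal_ext of_int x))"


section \<open>Values on the basis\<close>

abbreviation basis_L :: "int \<Rightarrow> witt_ext" where
  "basis_L n \<equiv> (Poly_Mapping.single n 1, 0)"

abbreviation basis_X :: "int \<Rightarrow> witt_ext" where
  "basis_X n \<equiv> (0, Poly_Mapping.single n 1)"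

lemma diagonal_ext_zero [simp]: "diagonal_ext c 0 = 0"
  by (simp add: diagonal_ext_def)

lemma wscale_Pair [simp]: "wscale c (x, a) = (pm_scale c x, pm_scale c a)"
  by (simp add: wscale_def prod_scale_def)

lemma WA_bracket_basis:
  "WA_bracket lam (basis_L n) (basis_L m) = wscale (of_int (m - n)) (basis_L (n + m))"
  "WA_bracket lam (basis_L n) (basis_X m) =
     wscale (of_int (n + m) + lam_term lam n * of_bool (m = 0)) (basis_X (n + m))"
  "WA_bracket lam (basis_X n) (basis_X m) = 0"
  by (simp_all add: WA_bracket_def semidirect_bracket_def witt_bracket_def act_A_def zero_prod_def)

lemma WB_bracket_basis:
  "WB_bracket lam (basis_L n) (basis_L m) = wscale (of_int (m - n)) (basis_L (n + m))"
  "WB_bracket lam (basis_L n) (basis_X m) =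
     wscale (of_int m - lam_term lam n * of_bool (n + m = 0)) (basis_X (n + m))"
  "WB_bracket lam (basis_X n) (basis_X m) = 0"
  by (simp_all add: WB_bracket_def semidirect_bracket_def witt_bracket_def act_B_def zero_prod_def)

lemma derivations_basis:
  "d_Ab (basis_L n) = 0" "d_Ab (basis_X n) = basis_X n"
  "lam \<noteq> Finite 0 \<Longrightarrow> d_A lam (basis_L n) = wscale (of_int n) (basis_X n)"
  "d_A (Finite 0) (basis_L n) = wscale (of_int (n * (n + 1))) (basis_X n)"
  "d_A lam (basis_X n) = 0"
  "d_B (Finite l) (basis_L 0) = wscale (l + 1) (basis_X 0)"
  "n \<noteq> 0 \<or> lam = Infinity \<Longrightarrow> d_B lam (basis_L n) = basis_X n"
  "d_B lam (basis_X n) = 0"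
  "del_B (basis_L n) = wscale (of_int n) (basis_X n)" "del_B (basis_X n) = 0"
  by (auto simp: d_Ab_def d_A_def d_B_def del_B_def zero_prod_def simp del: single_one
      split: proj_line.split)

end

theory Submission
  imports Defs
begin

text \<open>Since \<open>ad L\<^sub>0\<close> acts on the component of degree \<open>j\<close> of either algebra as multiplication by
  \<open>j\<close>, subtracting a suitable inner derivation makes any derivation \<open>D\<close> preserve degrees
  (\<open>ex_inner_homogeneous_on_L0\<close>, \<open>Der_homogeneous\<close>). Then \<open>D\<close> is given by four sequences of
  scalars, and the derivation property splits into four equations (\<open>Der_coordinates\<close>):

  \<^item> the part from the Witt algebra to itself is additive in the index, hence that of a multiple
    of \<open>ad L\<^sub>0\<close>, which can be subtracted (\<open>additive_off_diagonal\<close>);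
  \<^item> the part from the module to the Witt algebra is a module homomorphism and vanishes
    (\<open>no_weighted_hom_to_adjoint\<close>);
  \<^item> after that, the part from the module to itself is a module
    endomorphism, hence a scalar (\<open>weighted_endomorphism_constant\<close>), and this is the
    summand \<open>d_Ab\<close>;
  \<^item> the part from the Witt algebra to the module is \<open>L\<^sub>n \<mapsto> f n X\<^sub>n\<close> for a cocycle \<open>f\<close>.

  A derivation of the remaining form is inner exactly when its scalar is \<open>0\<close> and \<open>f\<close> is a multiple
  of \<open>n \<mapsto> c n 0\<close>, the cocycle of \<open>ad X\<^sub>0\<close> (\<open>outer_in_Inn_iff\<close>). All this depends only on a few
  properties of the structure constants \<open>c n m\<close>, and is done for both modules at once.

  What is left is to solve the recurrences for \<open>f\<close>. For \<open>A\<close> the solutions are spanned by \<open>n\<close> and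
  \<open>n\<^sup>2\<close>, one combination of which is a coboundary. For \<open>B\<close> all coboundaries are zero; one solution
  always exists, the constant sequence with a correction at \<open>n = 0\<close>, and a second one, \<open>n\<close>, only
  for \<open>\<lambda> = 0\<close>.

  Finally, \<open>relative_basis\<close> expresses that some vectors form a basis of a space modulo a
  subspace; it yields both the direct sum decomposition and the dimension of the quotient.\<close>

section \<open>Bases relative to a subspace\<close>

text \<open>The vectors form a list, not a set, so that independence also excludes repetitions and
  the position of a vector identifies its line in \<open>is_direct_sum\<close>.\<close>

definition (in vector_space) relative_basis :: "'b set \<Rightarrow> 'b set \<Rightarrow> 'b list \<Rightarrow> bool" where
  "relative_basis V U vs \<longleftrightarrow>
     subspace V \<and> subspace U \<and> U \<subseteq> V \<and> set vs \<subseteq> V \<and>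
     (\<forall>v\<in>V. \<exists>cs. length cs = length vs \<and> v - sum_list (map2 scale cs vs) \<in> U) \<and>
     (\<forall>cs. length cs = length vs \<longrightarrow> sum_list (map2 scale cs vs) \<in> U \<longrightarrow>
        cs = replicate (length vs) 0)"

context vector_space
begin

lemma sum_list_scale_diff:
  assumes "length cs = length vs" "length ds = length vs"
  shows "sum_list (map2 scale (map2 (-) cs ds) vs) =
    sum_list (map2 scale cs vs) - sum_list (map2 scale ds vs)"
  using assms
proof (induction vs arbitrary: cs ds)
  case (Cons v vs)
  then show ?case
    by (cases cs; cases ds) (auto simp: algebra_simps)
qed simp

lemma listset_lines:
  "listset (map (line scale) vs) = {map2 scale cs vs | cs. length cs = length vs}"
proof (induction vs)
  case (Cons v vs)
  show ?case
  proof (intro Set.set_eqI iffI)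
    fix xs assume "xs \<in> listset (map (line scale) (v # vs))"
    then obtain c cs where "xs = scale c v # map2 scale cs vs" "length cs = length vs"
      using Cons by (auto simp: set_Cons_def line_def)
    then show "xs \<in> {map2 scale cs (v # vs) | cs. length cs = length (v # vs)}"
      by (intro CollectI exI[of _ "c # cs"]) auto
  next
    fix xs assume "xs \<in> {map2 scale cs (v # vs) | cs. length cs = length (v # vs)}"
    then obtain cs where "xs = map2 scale cs (v # vs)" "length cs = Suc (length vs)"
      by auto
    then show "xs \<in> listset (map (line scale) (v # vs))"
      unfolding list.map listset.simps Cons
      by (cases cs) (auto simp: set_Cons_def line_def)
  qed
qed simp

lemma subspace_line: "subspace (line scale v)"
  unfolding line_def subspace_def
  by (auto intro: exI[of _ 0] simp flip: scale_left_distrib)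

lemma relative_basis_unique:
  assumes B: "relative_basis V U vs"
    and len: "length cs = length vs" "length ds = length vs"
    and mem: "sum_list (map2 scale cs vs) - sum_list (map2 scale ds vs) \<in> U"
  shows "cs = ds"
proof -
  have "sum_list (map2 scale (map2 (-) cs ds) vs) \<in> U"
    using mem len by (simp add: sum_list_scale_diff)
  then have eq: "map2 (-) cs ds = replicate (length vs) 0"
    using B len unfolding relative_basis_def by auto
  show ?thesis
  proof (rule nth_equalityI)
    fix i assume i: "i < length cs"
    then have "map2 (-) cs ds ! i = 0" using eq len by simp
    then show "cs ! i = ds ! i" using i len by simp
  qed (simp add: len)
qed

lemma relative_basis_in_carrier:
  assumes "relative_basis V U vs" "length cs = length vs"
  shows "sum_list (map2 scale cs vs) \<in> V"
proof -
  have V: "subspace V" "set vs \<subseteq> V" using assms(1) by (auto simp: relative_basis_def)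
  show ?thesis using assms(2) V(2)
  proof (induction vs arbitrary: cs)
    case Nil
    then show ?case using subspace_0[OF V(1)] by simp
  next
    case (Cons v vs)
    then show ?case
      by (cases cs) (auto intro!: subspace_add[OF V(1)] subspace_scale[OF V(1)])
  qed
qed

text \<open>Only the coefficients have to be unique: once they are fixed, the component in \<open>U\<close> is
  determined as a difference.\<close>

proposition relative_basis_direct_sum:
  assumes B: "relative_basis V U vs"
  shows "is_direct_sum scale V (U # map (line scale) vs)"
proof -
  have U: "subspace U" "subspace V" "U \<subseteq> V" using B by (auto simp: relative_basis_def)
  have ls: "listset (U # map (line scale) vs) =
      {u # map2 scale cs vs | u cs. u \<in> U \<and> length cs = length vs}"
    by (auto simp: listset_lines set_Cons_def)
  have "bij_betw sum_list (listset (U # map (line scale) vs)) V"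
    unfolding bij_betw_def
  proof
    show "inj_on sum_list (listset (U # map (line scale) vs))"
      unfolding ls
    proof (rule inj_onI, clarify)
      fix u cs u' ds
      assume mem: "u \<in> U" "u' \<in> U" and len: "length cs = length vs" "length ds = length vs"
        and eq: "sum_list (u # map2 scale cs vs) = sum_list (u' # map2 scale ds vs)"
      have "sum_list (map2 scale cs vs) - sum_list (map2 scale ds vs) = u' - u"
        using eq by (simp add: algebra_simps)
      then have "cs = ds"
        using relative_basis_unique[OF B len] subspace_diff[OF U(1)] mem by auto
      then show "u = u' \<and> map2 scale cs vs = map2 scale ds vs" using eq by simp
    qed
    show "sum_list ` listset (U # map (line scale) vs) = V"
    proof (intro subset_antisym subsetI)
      fix v assume "v \<in> sum_list ` listset (U # map (line scale) vs)"
      then show "v \<in> V"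
        using subspace_add[OF U(2)] relative_basis_in_carrier[OF B] U(3) unfolding ls by auto
    next
      fix v assume "v \<in> V"
      then obtain cs where cs: "length cs = length vs" "v - sum_list (map2 scale cs vs) \<in> U"
        using B by (auto simp: relative_basis_def)
      let ?l = "(v - sum_list (map2 scale cs vs)) # map2 scale cs vs"
      have "?l \<in> listset (U # map (line scale) vs)" "v = sum_list ?l"
        using cs unfolding ls by auto
      then show "v \<in> sum_list ` listset (U # map (line scale) vs)" by (metis imageI)
    qed
  qed
  then show ?thesis
    using U(1) subspace_line by (auto simp: is_direct_sum_def)
qed

end

section \<open>Dimension of a quotient space\<close>

definition coset :: "'v::ab_group_add set \<Rightarrow> 'v \<Rightarrow> 'v set" where
  "coset U v = {v + u | u. u \<in> U}"

context vector_space
begin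

context
  fixes U assumes U: "subspace U"
begin

lemma coset_eq_iff: "coset U v = coset U w \<longleftrightarrow> v - w \<in> U"
proof
  assume "coset U v = coset U w"
  moreover have "v \<in> coset U v"
    unfolding coset_def using subspace_0[OF U] by (auto intro!: exI[of _ 0])
  ultimately show "v - w \<in> U" by (auto simp: coset_def)
next
  assume d: "v - w \<in> U"
  have "v + u \<in> coset U w" if "u \<in> U" for u
    unfolding coset_def using subspace_add[OF U d that] by (auto intro!: exI[of _ "v - w + u"])
  moreover have "w + u \<in> coset U v" if "u \<in> U" for u
    unfolding coset_def using subspace_diff[OF U that d] by (auto intro!: exI[of _ "u - (v - w)"])
  ultimately show "coset U v = coset U w" by (auto simp: coset_def)
qed

lemma coset_0: "coset U 0 = U"
  by (auto simp: coset_def)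

lemma coset_add: "{x + y | x y. x \<in> coset U v \<and> y \<in> coset U w} = coset U (v + w)"
proof -
  have "\<exists>x y. v + w + u = x + y \<and> x \<in> coset U v \<and> y \<in> coset U w" if "u \<in> U" for u
    using that subspace_0[OF U]
    by (intro exI[of _ "v + u"] exI[of _ "w + 0"]) (auto simp: coset_def algebra_simps)
  moreover have "\<exists>u. (v + a) + (w + b) = v + w + u \<and> u \<in> U" if "a \<in> U" "b \<in> U" for a b
    using subspace_add[OF U that] by (intro exI[of _ "a + b"]) (simp add: algebra_simps)
  ultimately show ?thesis by (fastforce simp: coset_def)
qed

lemma coset_scale: "{scale c x + b | x b. x \<in> coset U v \<and> b \<in> U} = coset U (scale c v)"
proof -
  have "\<exists>x b. scale c v + u = scale c x + b \<and> x \<in> coset U v \<and> b \<in> U" if "u \<in> U" for u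
    using that subspace_0[OF U]
    by (intro exI[of _ "v + 0"] exI[of _ u]) (auto simp: coset_def intro!: exI[of _ 0])
  moreover have "\<exists>u. scale c (v + a) + b = scale c v + u \<and> u \<in> U" if "a \<in> U" "b \<in> U" for a b
    using subspace_add[OF U subspace_scale[OF U that(1)] that(2)]
    by (intro exI[of _ "scale c a + b"]) (simp add: algebra_simps)
  ultimately show ?thesis by (fastforce simp: coset_def)
qed

lemma quotient_space_simps:
  "carrier (quotient_space scale V U) = coset U ` V"
  "\<zero>\<^bsub>quotient_space scale V U\<^esub> = coset U 0"
  "coset U v \<oplus>\<^bsub>quotient_space scale V U\<^esub> coset U w = coset U (v + w)"
  "c \<odot>\<^bsub>quotient_space scale V U\<^esub> coset U v = coset U (scale c v)"
proof -
  show "carrier (quotient_space scale V U) = coset U ` V"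
    by (auto simp: quotient_space_def coset_def)
qed (simp_all add: quotient_space_def coset_0 coset_add coset_scale)

lemma vectorspace_quotient_space:
  assumes V: "subspace V"
  shows "vectorspace class_ring (quotient_space scale V U)"
proof -
  have "Module.module class_ring (quotient_space scale V U)"
  proof (rule module_criteria, goal_cases)
    case 1 show ?case by (rule class_cring.is_cring)
  next
    case 4
    show ?case
    proof
      fix X assume "X \<in> carrier (quotient_space scale V U)"
      then obtain v where v: "v \<in> V" "X = coset U v" by (auto simp: quotient_space_simps)
      then show "\<exists>Y\<in>carrier (quotient_space scale V U).
          X \<oplus>\<^bsub>quotient_space scale V U\<^esub> Y = \<zero>\<^bsub>quotient_space scale V U\<^esub>"
        using subspace_neg[OF V v(1)]
        by (intro bexI[of _ "coset U (- v)"]) (auto simp: quotient_space_simps)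
    qed
  qed (use subspace_0[OF V] subspace_add[OF V] subspace_scale[OF V] in
      \<open>auto simp: quotient_space_simps algebra_simps\<close>)
  then show ?thesis
    by (simp add: vectorspace_def class_field)
qed

text \<open>Linear combinations are taken over sets of vectors, hence the indexing by
  representatives and the injectivity assumption.\<close>

lemma lincomb_quotient_space:
  assumes V: "subspace V" and "finite I" and inj: "inj_on (\<lambda>i. coset U (w i)) I"
    and w: "\<And>i. i \<in> I \<Longrightarrow> w i \<in> V"
  shows "module.lincomb (quotient_space scale V U) a ((\<lambda>i. coset U (w i)) ` I) =
    coset U (\<Sum>i\<in>I. scale (a (coset U (w i))) (w i))"
proof -
  interpret Q: vectorspace class_ring "quotient_space scale V U"
    by (rule vectorspace_quotient_space[OF V])
  have closed: "coset U (scale (a (coset U (w i))) (w i)) \<in> carrier (quotient_space scale V U)"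
    if "i \<in> I" for i
    using w[OF that] subspace_scale[OF V] by (simp add: quotient_space_simps)
  have sum_closed: "coset U (\<Sum>i\<in>J. scale (a (coset U (w i))) (w i)) \<in>
      carrier (quotient_space scale V U)" if "J \<subseteq> I" for J
    unfolding quotient_space_simps
    by (intro imageI subspace_sum[OF V] subspace_scale[OF V] w) (use that in auto)
  have "Q.lincomb a ((\<lambda>i. coset U (w i)) ` J) = coset U (\<Sum>i\<in>J. scale (a (coset U (w i))) (w i))"
    if "finite J" "J \<subseteq> I" for J
    using that
  proof (induction J)
    case empty
    show ?case by (simp add: Q.lincomb_def quotient_space_simps)
  next
    case (insert j J)
    have new: "coset U (w j) \<notin> (\<lambda>i. coset U (w i)) ` J"
      using inj insert by (auto simp: inj_on_def)
    show ?case
      unfolding Q.lincomb_def image_insert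
      by (subst Q.M.finsum_insert)
        (use insert new closed sum_closed in
          \<open>auto simp: quotient_space_simps Q.lincomb_def\<close>)
  qed
  then show ?thesis using \<open>finite I\<close> by simp
qed

end

text \<open>The cosets of a relative basis are a basis of the quotient: independence modulo \<open>U\<close>
  makes them pairwise distinct and linearly independent, and every \<open>v \<in> V\<close> differs from a
  linear combination of the list by an element of \<open>U\<close>.\<close>

proposition relative_basis_dimension:
  assumes B: "relative_basis V U vs"
  shows "has_dimension (quotient_space scale V U) (length vs)"
proof -
  let ?Q = "quotient_space scale V U" and ?n = "length vs"
  define K where "K = (\<lambda>i. coset U (vs ! i))"
  have V: "subspace V" and U: "subspace U" and vs: "set vs \<subseteq> V"
    using B by (auto simp: relative_basis_def)
  have spanning: "\<forall>v\<in>V. \<exists>cs. length cs = ?n \<and> v - sum_list (map2 scale cs vs) \<in> U"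
    using B unfolding relative_basis_def by (elim conjE)
  interpret Q: vectorspace class_ring ?Q
    by (rule vectorspace_quotient_space[OF U V])
  have comb: "sum_list (map2 scale (map c [0..<?n]) vs) = (\<Sum>i<?n. scale (c i) (vs ! i))" for c
    by (simp add: sum_list_sum_nth atLeast0LessThan)
  have indep: "c i = 0" if "(\<Sum>i<?n. scale (c i) (vs ! i)) \<in> U" "i < ?n" for c i
  proof -
    have "map c [0..<?n] = replicate ?n 0"
      using B that(1) unfolding relative_basis_def comb[symmetric] by auto
    then have "map c [0..<?n] ! i = replicate ?n 0 ! i" by simp
    then show ?thesis using that(2) by simp
  qed
  have inj: "inj_on K {..<?n}"
  proof (rule inj_onI, rule ccontr)
    fix i j assume ij: "i \<in> {..<?n}" "j \<in> {..<?n}" "K i = K j" "i \<noteq> j"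
    \<comment> \<open>Equal cosets at different positions would give the relation \<open>vs ! i - vs ! j \<in> U\<close>.\<close>
    let ?c = "\<lambda>k. if k = i then 1 :: 'a else if k = j then - 1 else 0"
    have "(\<Sum>k<?n. scale (?c k) (vs ! k)) =
        (\<Sum>k<?n. (if k = i then vs ! i else 0) - (if k = j then vs ! j else 0))"
      using ij(4) by (intro sum.cong) auto
    also have "\<dots> = vs ! i - vs ! j"
      using ij by (simp add: sum_subtractf)
    also have "\<dots> \<in> U"
      using ij(3) coset_eq_iff[OF U] by (simp add: K_def)
    finally have "(\<Sum>k<?n. scale (?c k) (vs ! k)) \<in> U" .
    then have "?c i = 0" using indep[of ?c i] ij(1) by simp
    then show False by simp
  qed
  have lin: "Q.lincomb a (K ` {..<?n}) = coset U (\<Sum>i<?n. scale (a (K i)) (vs ! i))" for a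
    unfolding K_def
    by (rule lincomb_quotient_space[OF U V]) (use inj vs in \<open>auto simp: K_def subset_iff\<close>)
  have carrier: "K ` {..<?n} \<subseteq> carrier ?Q"
    using vs by (auto simp: quotient_space_simps[OF U] K_def subset_iff)
  have "Q.lin_indpt (K ` {..<?n})"
  proof (rule Q.finite_lin_indpt2[OF _ carrier])
    fix a assume "Q.lincomb a (K ` {..<?n}) = \<zero>\<^bsub>?Q\<^esub>"
    then have "(\<Sum>i<?n. scale (a (K i)) (vs ! i)) \<in> U"
      unfolding lin quotient_space_simps[OF U] coset_eq_iff[OF U] by simp
    then have "a (K i) = 0" if "i < ?n" for i
      using indep[of "\<lambda>i. a (K i)"] that by blast
    then show "\<forall>v\<in>K ` {..<?n}. a v = \<zero>\<^bsub>class_ring\<^esub>" by auto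
  qed simp
  moreover have gen: "Q.span (K ` {..<?n}) = carrier ?Q"
  proof -
    have "coset U v \<in> {Q.lincomb a (K ` {..<?n}) | a. a \<in> K ` {..<?n} \<rightarrow> carrier class_ring}"
      if v: "v \<in> V" for v
    proof -
      obtain cs where cs: "length cs = ?n" "v - sum_list (map2 scale cs vs) \<in> U"
        using spanning v by blast
      define a where "a = (\<lambda>X. cs ! the_inv_into {..<?n} K X)"
      have "(\<Sum>i<?n. scale (a (K i)) (vs ! i)) = (\<Sum>i<?n. scale (cs ! i) (vs ! i))"
        unfolding a_def using the_inv_into_f_f[OF inj] by (intro sum.cong) auto
      also have "\<dots> = sum_list (map2 scale cs vs)"
        using comb[of "(!) cs"] cs(1) map_nth[of cs] by simp
      finally have "Q.lincomb a (K ` {..<?n}) = coset U v"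
        unfolding lin coset_eq_iff[OF U]
        using subspace_neg[OF U cs(2)] by simp
      then show ?thesis by (intro CollectI exI[of _ a]) auto
    qed
    moreover have "Q.lincomb a (K ` {..<?n}) \<in> carrier ?Q" for a
      using carrier by (intro Q.lincomb_closed) auto
    ultimately show ?thesis
      unfolding Q.finite_span[OF finite_imageI[OF finite_lessThan] carrier]
      by (auto simp: quotient_space_simps[OF U])
  qed
  ultimately have "Q.basis (K ` {..<?n})"
    using carrier by (simp add: Q.basis_def)
  then have "Q.dim = card (K ` {..<?n})" by (intro Q.dim_basis) auto
  also have "\<dots> = ?n" using card_image[OF inj] by simp
  finally show ?thesis
    unfolding has_dimension_def Q.fin_dim_def
    using Q.vectorspace_axioms carrier gen by (auto intro!: exI[of _ "K ` {..<?n}"])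
qed

end


section \<open>Finitely supported functions in coordinates\<close>

text \<open>The basis vectors of index \<open>0\<close> have to keep the shape of all the others; the simplifier
  would turn them into the unit of the convolution product.\<close>

declare single_one [simp del]

lemma lookup_diagonal_ext [simp]:
  "Poly_Mapping.lookup (diagonal_ext f x) n = f n * Poly_Mapping.lookup x n"
  unfolding diagonal_ext_def
  by (cases "n \<in> Poly_Mapping.keys x")
    (auto simp: lookup_sum lookup_single when_def in_keys_iff)

lemma diagonal_ext_linear:
  "diagonal_ext f (x + y) = diagonal_ext f x + diagonal_ext f y"
  "diagonal_ext f (pm_scale k x) = pm_scale k (diagonal_ext f x)"
  by (auto intro!: poly_mapping_eqI simp: lookup_add algebra_simps)

lemma lookup_bilinear_ext_single_left:
  "Poly_Mapping.lookup (bilinear_ext c (Poly_Mapping.single n a) g) k =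
     a * c n (k - n) * Poly_Mapping.lookup g (k - n)"
  by (induction g rule: pm_induct)
    (auto simp: lookup_single when_def bilinear_ext_add_right lookup_add algebra_simps)

lemma lookup_bilinear_ext_single_right:
  "Poly_Mapping.lookup (bilinear_ext c g (Poly_Mapping.single m b)) k =
     b * c (k - m) m * Poly_Mapping.lookup g (k - m)"
  by (induction g rule: pm_induct)
    (auto simp: lookup_single when_def bilinear_ext_add_left lookup_add algebra_simps)

lemma eq_single_if_supported:
  assumes "\<And>k. k \<noteq> m \<Longrightarrow> Poly_Mapping.lookup f k = 0"
  shows "f = Poly_Mapping.single m (Poly_Mapping.lookup f m)"
  by (rule poly_mapping_eqI) (use assms in \<open>auto simp: lookup_single when_def\<close>)

lemma pm_scale_linear:
  "pm_scale k (x + y) = pm_scale k x + pm_scale k y"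
  "pm_scale k 0 = 0" "pm_scale 0 x = 0" "pm_scale 1 x = x"
  "pm_scale (k + l) x = pm_scale k x + pm_scale l x"
  "pm_scale k (pm_scale l x) = pm_scale (k * l) x"
  by (auto intro!: poly_mapping_eqI simp: lookup_add algebra_simps)

section \<open>Linear maps on the semi-direct sums\<close>

lemma wscale_linear_iff:
  "Vector_Spaces.linear wscale wscale D \<longleftrightarrow>
     (\<forall>u v. D (u + v) = D u + D v) \<and> (\<forall>k u. D (wscale k u) = wscale k (D u))"
  unfolding Vector_Spaces.linear_def module_hom_def module_hom_axioms_def
  using WA.vector_space_axioms WA.module_axioms by blast

lemma linear_eq_on_basis:
  assumes D: "Vector_Spaces.linear wscale wscale D" and E: "Vector_Spaces.linear wscale wscale E"
    and L: "\<And>n. D (basis_L n) = E (basis_L n)" and X: "\<And>n. D (basis_X n) = E (basis_X n)"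
  shows "D = E"
proof
  fix v :: witt_ext
  have add: "D (u + v) = D u + D v" "E (u + v) = E u + E v" for u v
    using D E unfolding wscale_linear_iff by blast+
  have scale: "D (wscale k u) = wscale k (D u)" "E (wscale k u) = wscale k (E u)" for k u
    using D E unfolding wscale_linear_iff by blast+
  have zero: "D 0 = E 0"
    using scale[of 0 0] by (metis WA.scale_zero_left)
  have 1: "D (x, 0) = E (x, 0)" for x
  proof (induction x rule: pm_induct)
    case (single n a)
    have "(Poly_Mapping.single n a, 0) = wscale a (basis_L n)" by (simp add: pm_scale_linear)
    then show ?case by (simp only: scale L)
  next
    case sum: (add f g)
    have "(f + g, 0) = (f, 0) + (g, 0 :: int \<Rightarrow>\<^sub>0 complex)" by simp
    then show ?case using sum by (simp only: add)
  qed (use zero in \<open>simp add: zero_prod_def\<close>)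
  have 2: "D (0, x) = E (0, x)" for x
  proof (induction x rule: pm_induct)
    case (single n a)
    have "(0, Poly_Mapping.single n a) = wscale a (basis_X n)" by (simp add: pm_scale_linear)
    then show ?case by (simp only: scale X)
  next
    case sum: (add f g)
    have "(0, f + g) = (0 :: int \<Rightarrow>\<^sub>0 complex, f) + (0, g)" by simp
    then show ?case using sum by (simp only: add)
  qed (use zero in \<open>simp add: zero_prod_def\<close>)
  obtain x y where v: "v = (x, y)" by (cases v)
  then have v: "v = (x, 0) + (0, y)" by simp
  show "D v = E v" unfolding v add 1 2 ..
qed

lemma vector_space_fun_scale:
  assumes "vector_space s"
  shows "vector_space (fun_scale s)"
proof -
  interpret vector_space s by (rule assms)
  show ?thesis
    by unfold_locales (auto simp: fun_scale_def fun_eq_iff algebra_simps)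
qed

interpretation endo: vector_space "fun_scale wscale :: complex \<Rightarrow> (witt_ext \<Rightarrow> witt_ext) \<Rightarrow> _"
  by (rule vector_space_fun_scale) unfold_locales


section \<open>Derivations of a semi-direct sum with a weighted module\<close>

text \<open>Both modules send \<open>L\<^sub>n \<otimes> X\<^sub>m\<close> to a multiple \<open>c n m\<close> of \<open>X\<^bsub>n+m\<^esub>\<close>, and they are treated together
  through the few properties of \<open>c\<close> that decide which derivations exist. By \<open>weight\<close>, the
  element \<open>L\<^sub>0\<close> measures the degree on the whole algebra. By \<open>nonzero\<close>, any two degrees other
  than \<open>0\<close> are joined by a nonzero coefficient; by \<open>link\<close>, degree \<open>0\<close> is joined to some other
  degree, possibly in one direction only, as in the trivial quotient of \<open>A(0)\<close> and the trivial
  submodule of \<open>B(0)\<close>.\<close>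

locale witt_extension =
  fixes c :: "int \<Rightarrow> int \<Rightarrow> complex"
  assumes module: "lie_module pm_scale witt_bracket pm_scale (bilinear_ext c)"
    and weight: "c 0 m = of_int m"
    and nonzero: "m \<noteq> 0 \<Longrightarrow> n + m \<noteq> 0 \<Longrightarrow> c n m \<noteq> 0"
    and link: "\<exists>n. n \<noteq> 0 \<and> (c n 0 \<noteq> 0 \<or> c n (- n) \<noteq> 0)"
begin

definition br :: "witt_ext \<Rightarrow> witt_ext \<Rightarrow> witt_ext" where
  "br = semidirect_bracket witt_bracket (bilinear_ext c)"

sublocale lie_algebra wscale br
  unfolding wscale_def br_def
  by (rule lie_module.lie_algebra_semidirect[OF module])

text \<open>The condition on \<open>f\<close> under which \<open>L\<^sub>n \<mapsto> f n X\<^sub>n\<close> is a 1-cocycle of the Witt algebra with values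
  in the module.\<close>

definition cocycle :: "(int \<Rightarrow> complex) \<Rightarrow> bool" where
  "cocycle f \<longleftrightarrow> (\<forall>n m. of_int (m - n) * f (n + m) = c n m * f m - c m n * f n)"

text \<open>The normal form of a derivation modulo inner ones: it preserves degrees, is the scalar \<open>a\<close>
  on the module, and maps the Witt algebra to the module by \<open>f\<close>, which has to be a cocycle.\<close>

definition outer :: "complex \<Rightarrow> (int \<Rightarrow> complex) \<Rightarrow> witt_ext \<Rightarrow> witt_ext" where
  "outer a f = (\<lambda>(x, y). (0, pm_scale a y + diagonal_ext f x))"

lemma br_Pair: "br (x, a) (y, b) = (witt_bracket x y, bilinear_ext c x b - bilinear_ext c y a)"
  by (simp add: br_def semidirect_bracket_def)

lemma Der_iff:
  "D \<in> Der \<longleftrightarrow> (\<forall>u v. D (u + v) = D u + D v) \<and> (\<forall>k u. D (wscale k u) = wscale k (D u)) \<and>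
     (\<forall>u v. D (br u v) = br (D u) v + br u (D v))"
  by (auto simp: Der_def wscale_linear_iff)

lemma Der_bracket: "D \<in> Der \<Longrightarrow> D (br u v) = br (D u) v + br u (D v)"
  and Der_scale: "D \<in> Der \<Longrightarrow> D (wscale k u) = wscale k (D u)"
  by (simp_all only: Der_iff)

lemma Der_linear: "D \<in> Der \<Longrightarrow> Vector_Spaces.linear wscale wscale D"
  by (simp add: Der_def)

lemma br_zero: "br 0 v = 0" "br v 0 = 0"
proof -
  obtain x a where "v = (x, a)" by (cases v)
  then show "br 0 v = 0" "br v 0 = 0"
    unfolding zero_prod_def by (simp_all add: br_Pair)
qed

lemma subspace_Der: "endo.subspace Der"
  unfolding endo.subspace_def
proof (intro conjI ballI allI)
  show "0 \<in> Der"
    unfolding Der_iff zero_fun_def by (simp add: br_zero WA.scale_zero_right del: split_paired_All wscale_Pair)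
next
  fix D E assume "D \<in> Der" "E \<in> Der"
  then show "D + E \<in> Der"
    unfolding Der_iff plus_fun_def
    by (simp only: bracket_add_left bracket_add_right WA.scale_right_distrib ac_simps simp_thms)
next
  fix k D assume "D \<in> Der"
  then show "fun_scale wscale k D \<in> Der"
    unfolding Der_iff fun_scale_def
    by (simp only: bracket_scale_left bracket_scale_right WA.scale_right_distrib
        WA.scale_left_commute simp_thms)
qed

lemma subspace_Inn: "endo.subspace Inn"
  unfolding endo.subspace_def Inn_def
proof (intro conjI ballI allI)
  show "0 \<in> {br x |x. True}"
    by (intro CollectI exI[of _ 0]) (auto intro!: ext simp only: br_zero zero_fun_def)
  fix f g k assume "f \<in> {br x |x. True}"
  then obtain x where x: "f = br x" by auto
  have "fun_scale wscale k f = br (wscale k x)"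
    by (rule ext) (simp only: x fun_scale_def bracket_scale_left)

  then show "fun_scale wscale k f \<in> {br x |x. True}" by blast
  assume "g \<in> {br x |x. True}"
  then obtain y where y: "g = br y" by auto
  have "f + g = br (x + y)"
    by (rule ext) (simp only: x y plus_fun_def bracket_add_left)

  then show "f + g \<in> {br x |x. True}" by blast
qed

lemma Inn_subset_Der: "Inn \<subseteq> Der"
proof -
  have "br x (br y z) = br (br x y) z + br y (br x z)" for x y z
  proof -
    have "br x (br y z) = - br y (br z x) - br z (br x y)"
      using jacobi[of x y z] by (simp add: eq_neg_iff_add_eq_0 algebra_simps)
    moreover have "br z (br x y) = - br (br x y) z" by (rule bracket_swap)
    moreover have "br y (br z x) = - br y (br x z)"
      using bracket_swap[of z x] bracket_scale_right[of y "- 1" "br x z"] by simp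
    ultimately show ?thesis by simp
  qed
  then have "br x \<in> Der" for x
    unfolding Der_iff using bracket_add_right bracket_scale_right by blast
  then show ?thesis
    unfolding Inn_def by blast
qed

lemma outer_basis:
  "outer a f (basis_L n) = (0, Poly_Mapping.single n (f n))"
  "outer a f (basis_X n) = (0, Poly_Mapping.single n a)"
  by (simp_all add: outer_def pm_scale_linear)

lemma outer_linear: "Vector_Spaces.linear wscale wscale (outer a f)"
  by (auto simp: wscale_linear_iff outer_def pm_scale_linear diagonal_ext_linear ac_simps)

lemma outer_in_Der:
  assumes "cocycle f"
  shows "outer a f \<in> Der"
proof -
  let ?C = "\<lambda>x y. diagonal_ext f (witt_bracket x y) =
    bilinear_ext c x (diagonal_ext f y) - bilinear_ext c y (diagonal_ext f x)"
  have C: "?C x y" for x y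
  proof (induction x rule: pm_induct)
    case (single n a)
    show ?case
    proof (induction y rule: pm_induct)
      case (single m b)
      have "a * b * (of_int (m - n) * f (n + m)) = a * b * (c n m * f m - c m n * f n)"
        using assms unfolding cocycle_def by metis
      then have "a * b * of_int (m - n) * f (n + m) = a * (b * f m) * c n m - b * (a * f n) * c m n"
        by (simp add: algebra_simps)
      then show ?case
        by (simp add: witt_bracket_def add.commute[of m n] flip: single_diff of_int_diff)
    qed (simp_all add: diagonal_ext_linear bilinear_ext_simps algebra_simps)
  qed (simp_all add: diagonal_ext_linear bilinear_ext_simps algebra_simps)
  have "outer a f (br u v) = br (outer a f u) v + br u (outer a f v)" for u v
  proof -
    obtain x y x' y' where uv: "u = (x, y)" "v = (x', y')" by (cases u; cases v)
    have "bilinear_ext c 0 w = 0" for w by simp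
    then show ?thesis
      unfolding uv
      by (simp add: br_Pair outer_def C bilinear_ext_simps pm.scale_right_diff_distrib algebra_simps)
  qed
  then show ?thesis
    using outer_linear[of a f] by (simp add: Der_def)
qed


lemma Der_diff_inner: "D \<in> Der \<Longrightarrow> D - br z \<in> Der"
  by (rule endo.subspace_diff[OF subspace_Der])
    (assumption, rule subsetD[OF Inn_subset_Der], unfold Inn_def, blast)

lemma bracket_basis_L0:
  "br (x, y) (basis_L 0) = (diagonal_ext (\<lambda>j. - of_int j) x, diagonal_ext (\<lambda>j. - of_int j) y)"
  by (auto intro!: poly_mapping_eqI simp: br_Pair witt_bracket_def weight
      lookup_bilinear_ext_single_left lookup_bilinear_ext_single_right)

lemma basis_L0_bracket:
  "br (basis_L 0) (x, y) = (diagonal_ext of_int x, diagonal_ext of_int y)"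
  by (auto intro!: poly_mapping_eqI simp: br_Pair witt_bracket_def weight
      lookup_bilinear_ext_single_left lookup_bilinear_ext_single_right)

definition homogeneous :: "int \<Rightarrow> witt_ext \<Rightarrow> bool" where
  "homogeneous m v \<longleftrightarrow> (\<exists>a b. v = (Poly_Mapping.single m a, Poly_Mapping.single m b))"

text \<open>Since \<open>ad L\<^sub>0\<close> multiplies degree \<open>j\<close> by \<open>j\<close>, it is invertible on all components of
  \<open>D L\<^sub>0\<close> of degree other than \<open>0\<close>; dividing these by \<open>- j\<close> gives the element \<open>z\<close> with
  \<open>[z, L\<^sub>0]\<close> equal to them.\<close>

lemma ex_inner_homogeneous_on_L0:
  "\<exists>z. homogeneous 0 ((D - br z) (basis_L 0))"
proof -
  obtain p q where pq: "D (basis_L 0) = (p, q)" by (cases "D (basis_L 0)")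
  \<comment> \<open>At \<open>j = 0\<close> the coefficient is \<open>- 1 / 0 = 0\<close>, so that \<open>z\<close> has no component there.\<close>
  define z where "z = (diagonal_ext (\<lambda>j. - 1 / of_int j) p, diagonal_ext (\<lambda>j. - 1 / of_int j) q)"
  have off: "Poly_Mapping.lookup (r - diagonal_ext (\<lambda>j. - of_int j) (diagonal_ext (\<lambda>j. - 1 / of_int j) r)) k
      = 0" if "k \<noteq> 0" for k and r :: "int \<Rightarrow>\<^sub>0 complex"
    using that by (simp add: lookup_minus)
  have "(D - br z) (basis_L 0) =
      (p - diagonal_ext (\<lambda>j. - of_int j) (diagonal_ext (\<lambda>j. - 1 / of_int j) p),
       q - diagonal_ext (\<lambda>j. - of_int j) (diagonal_ext (\<lambda>j. - 1 / of_int j) q))"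
    by (simp add: pq z_def bracket_basis_L0)
  then show ?thesis
    unfolding homogeneous_def using eq_single_if_supported[of 0, OF off] by metis
qed

text \<open>Apply \<open>D\<close> to \<open>[L\<^sub>0, v] = m v\<close>. The term \<open>[D L\<^sub>0, v]\<close> has degree \<open>m\<close>, so the component of
  \<open>D v\<close> in degree \<open>k\<close> satisfies \<open>m (D v)\<^sub>k = k (D v)\<^sub>k\<close> when \<open>k \<noteq> m\<close>.\<close>

lemma Der_homogeneous:
  assumes D: "D \<in> Der" and L0: "homogeneous 0 (D (basis_L 0))"
    and v: "v = basis_L m \<or> v = basis_X m"
  shows "homogeneous m (D v)"
proof -
  obtain s t where st: "D (basis_L 0) = (Poly_Mapping.single 0 s, Poly_Mapping.single 0 t)"
    using L0 by (auto simp: homogeneous_def)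
  obtain x y where xy: "D v = (x, y)" by (cases "D v")
  have "br (basis_L 0) v = wscale (of_int m) v"
    using v by (auto simp: basis_L0_bracket)
  then have "wscale (of_int m) (D v) = br (D (basis_L 0)) v + br (basis_L 0) (D v)"
    using Der_bracket[OF D] Der_scale[OF D] by metis
  moreover have "homogeneous m (br (D (basis_L 0)) v)"
    using v by (auto simp: st br_Pair homogeneous_def witt_bracket_def simp flip: single_uminus)
      (metis single_zero)+
  then obtain a b where "br (D (basis_L 0)) v = (Poly_Mapping.single m a, Poly_Mapping.single m b)"
    by (auto simp: homogeneous_def)
  ultimately have eq: "pm_scale (of_int m) x = Poly_Mapping.single m a + diagonal_ext of_int x"
    "pm_scale (of_int m) y = Poly_Mapping.single m b + diagonal_ext of_int y"
    by (simp_all add: xy basis_L0_bracket)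
  have "Poly_Mapping.lookup x k = 0" "Poly_Mapping.lookup y k = 0" if "k \<noteq> m" for k
    using that arg_cong[OF eq(1), of "\<lambda>f. Poly_Mapping.lookup f k"]
      arg_cong[OF eq(2), of "\<lambda>f. Poly_Mapping.lookup f k"]
    by (auto simp: lookup_add lookup_single)
  then show ?thesis
    unfolding homogeneous_def xy
    using eq_single_if_supported[of m x] eq_single_if_supported[of m y] by metis
qed

end

text \<open>This is \<open>H\<^sup>1\<close> of the Witt algebra with adjoint coefficients in degree \<open>0\<close>: a degree-preserving
  derivation is additive in the index away from the diagonal, because \<open>[L\<^sub>n, L\<^sub>m]\<close> vanishes
  for \<open>n = m\<close>. The value at \<open>2\<close>, which is not reached from \<open>1 + 1\<close>, comes from
  \<open>2 + (-1) = 1\<close>.\<close>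

lemma additive_off_diagonal:
  fixes a :: "int \<Rightarrow> complex"
  assumes "\<And>n m. n \<noteq> m \<Longrightarrow> a (n + m) = a n + a m" and a1: "a 1 = 0"
  shows "a n = 0"
proof -
  have a0: "a 0 = 0" using assms(1)[of 0 1] by simp
  have up: "a (k + 1) = a k" if "k \<noteq> 1" for k using assms(1)[of k 1] that a1 by simp
  have neg: "a (- int k) = 0" for k
    by (induction k) (use a0 up[of "- int (Suc k)" for k] in auto)
  have a2: "a 2 = 0" using assms(1)[of 2 "- 1"] neg[of 1] a1 by simp
  have pos: "a (int k + 2) = 0" for k
  proof (induction k)
    case (Suc k)
    then show ?case using up[of "int k + 2"] by (simp add: algebra_simps)
  qed (simp add: a2)
  consider "n \<le> 0" | "n = 1" | "n \<ge> 2" by linarith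
  then show ?thesis
  proof cases
    case 1 then show ?thesis using neg[of "nat (- n)"] by simp
  next
    case 2 then show ?thesis using a1 by simp
  next
    case 3 then show ?thesis using pos[of "nat (n - 2)"] by simp
  qed
qed

context witt_extension
begin

text \<open>A degree-preserving module map from \<open>X\<close> to the adjoint module vanishes. The relation with
  \<open>n = m\<close> kills all even degrees except \<open>0\<close>, as \<open>[L\<^sub>m, L\<^sub>m] = 0\<close>; any other degree is moved into
  those by a suitable \<open>L\<^sub>n\<close> that acts injectively on it in the adjoint module.\<close>

lemma no_weighted_hom_to_adjoint:
  assumes hom: "\<And>n m. c n m * p (n + m) = of_int (m - n) * p m"
  shows "p m = 0"
proof -
  have even: "p k = 0" if k: "even k" "k \<noteq> 0" for k
  proof -
    define n where "n = k div 2"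
    have n: "n + n = k" "n \<noteq> 0" using k by (auto simp: n_def)
    then have "c n n * p k = 0" using hom[of n n] by simp
    then show ?thesis using nonzero[of n n] n k by simp
  qed
  consider "m = 0" | "m \<noteq> 0" "even m" | "odd m" by blast
  then show ?thesis
  proof cases
    case 1
    then show ?thesis using hom[of 2 0] even[of 2] by simp
  next
    case 2 then show ?thesis using even by simp
  next
    case 3
    \<comment> \<open>an odd number different from both \<open>m\<close> and \<open>- m\<close>\<close>
    define n where "n = (if m = 1 then 3 else if m = - 1 then - 3 else if m > 0 then 1 else - 1 :: int)"
    have n: "odd n" "n \<noteq> m" "n + m \<noteq> 0" using 3 by (auto simp: n_def)
    then have "p (n + m) = 0" using even 3 by simp
    then show ?thesis using hom[of n m] n(2) by simp
  qed
qed

text \<open>A degree-preserving endomorphism of \<open>X\<close> takes the same value in any two degrees that are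
  joined by a nonzero coefficient of the action, and these connect all degrees.\<close>

lemma weighted_endomorphism_constant:
  assumes hom: "\<And>n m. c n m * (q (n + m) - q m) = 0"
  shows "q m = q (1 :: int)"
proof -
  have step: "q (n + m) = q m" if "m \<noteq> 0" "n + m \<noteq> 0" for n m
    using hom[of n m] nonzero[OF that] by simp
  have off0: "q m = q 1" if "m \<noteq> 0" for m
    using step[of 1 "m - 1"] that by simp
  obtain n where n: "n \<noteq> 0" "c n 0 \<noteq> 0 \<or> c n (- n) \<noteq> 0" using link by blast
  have "q n = q 0 \<or> q 0 = q (- n)"
    using n(2) hom[of n 0] hom[of n "- n"] by (elim disjE) simp_all
  moreover have "q n = q 1" "q (- n) = q 1" using n(1) by (auto intro: off0)
  ultimately have "q 0 = q 1" by metis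
  then show ?thesis by (cases "m = 0") (auto intro: off0)
qed

text \<open>The four component equations of a degree-preserving derivation: the two components of
  \<open>D [L\<^sub>n, L\<^sub>m]\<close> and the two of \<open>D [L\<^sub>n, X\<^sub>m]\<close>.\<close>

lemma Der_coordinates:
  assumes D: "D \<in> Der"
    and L: "\<And>n. D (basis_L n) = (Poly_Mapping.single n (\<alpha> n), Poly_Mapping.single n (f n))"
    and X: "\<And>n. D (basis_X n) = (Poly_Mapping.single n (p n), Poly_Mapping.single n (q n))"
  shows "of_int (m - n) * \<alpha> (n + m) = of_int (m - n) * (\<alpha> n + \<alpha> m)"
    and "cocycle f"
    and "c n m * p (n + m) = of_int (m - n) * p m"
    and "c n m * (q (n + m) - q m) = \<alpha> n * c n m"
proof -
  have der: "D (br u v) = br (D u) v + br u (D v)" and sc: "D (wscale k u) = wscale k (D u)" for u v k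
    by (rule Der_bracket[OF D], rule Der_scale[OF D])
  have LL: "br (basis_L n) (basis_L m) = wscale (of_int (m - n)) (basis_L (n + m))" for n m
    by (simp add: br_Pair witt_bracket_def)
  have LX: "br (basis_L n) (basis_X m) = wscale (c n m) (basis_X (n + m))" for n m
    by (simp add: br_Pair)
  have 1: "wscale (of_int (m - n)) (D (basis_L (n + m))) =
      br (D (basis_L n)) (basis_L m) + br (basis_L n) (D (basis_L m))" for n m
    using der[of "basis_L n" "basis_L m"] unfolding LL sc .
  have 2: "wscale (c n m) (D (basis_X (n + m))) =
      br (D (basis_L n)) (basis_X m) + br (basis_L n) (D (basis_X m))" for n m
    using der[of "basis_L n" "basis_X m"] unfolding LX sc .
  have fst1: "of_int (m - n) * \<alpha> (n + m) = of_int (m - n) * (\<alpha> n + \<alpha> m)" for n m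
    using arg_cong[OF 1[of m n], of "\<lambda>v. Poly_Mapping.lookup (fst v) (n + m)"]
    unfolding L by (simp add: br_Pair witt_bracket_def lookup_add lookup_minus algebra_simps)
  show "of_int (m - n) * \<alpha> (n + m) = of_int (m - n) * (\<alpha> n + \<alpha> m)"
    by (rule fst1)
  have "of_int (m - n) * f (n + m) = c n m * f m - c m n * f n" for n m
    using arg_cong[OF 1[of m n], of "\<lambda>v. Poly_Mapping.lookup (snd v) (n + m)"]
    unfolding L by (simp add: br_Pair witt_bracket_def lookup_add lookup_minus add.commute[of m n] mult.commute)
  then show "cocycle f" by (simp add: cocycle_def)
  show "c n m * p (n + m) = of_int (m - n) * p m"
    using arg_cong[OF 2[of n m], of "\<lambda>v. Poly_Mapping.lookup (fst v) (n + m)"]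
    unfolding L X by (simp add: br_Pair witt_bracket_def lookup_add lookup_minus mult.commute)
  show "c n m * (q (n + m) - q m) = \<alpha> n * c n m"
    using arg_cong[OF 2[of n m], of "\<lambda>v. Poly_Mapping.lookup (snd v) (n + m)"]
    unfolding L X by (simp add: br_Pair witt_bracket_def lookup_add lookup_minus algebra_simps)
qed

text \<open>After subtracting \<open>ad z\<close> the derivation preserves degrees, and on the Witt algebra its
  adjoint part is \<open>s ad L\<^sub>0\<close>, where \<open>s\<close> is read off at \<open>L\<^sub>1\<close>. Subtracting this too leaves
  only a scalar on \<open>X\<close> and a cocycle.\<close>

proposition Der_normal_form:
  assumes D: "D \<in> Der"
  obtains a f where "cocycle f" "D - outer a f \<in> Inn"
proof -
  obtain z where z: "homogeneous 0 ((D - br z) (basis_L 0))"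
    using ex_inner_homogeneous_on_L0[of D] by (elim exE)
  define s where "s = Poly_Mapping.lookup (fst ((D - br z) (basis_L 1))) 1"
  define w where "w = (Poly_Mapping.single (0::int) s, 0 :: int \<Rightarrow>\<^sub>0 complex)"
  define E where "E = D - br z - br w"
  have E_Der: "E \<in> Der"
    unfolding E_def by (intro Der_diff_inner D)
  have "br w (basis_L 0) = 0"
    by (simp add: w_def br_Pair witt_bracket_def zero_prod_def)
  then have E0: "homogeneous 0 (E (basis_L 0))"
    using z by (simp add: E_def)
  have "\<exists>a b. E (basis_L n) = (Poly_Mapping.single n a, Poly_Mapping.single n b)" for n
    using Der_homogeneous[OF E_Der E0, of _ n] by (auto simp: homogeneous_def)
  then obtain \<alpha> f where L: "\<And>n. E (basis_L n) = (Poly_Mapping.single n (\<alpha> n), Poly_Mapping.single n (f n))"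
    by metis
  have "\<exists>a b. E (basis_X n) = (Poly_Mapping.single n a, Poly_Mapping.single n b)" for n
    using Der_homogeneous[OF E_Der E0, of _ n] by (auto simp: homogeneous_def)
  then obtain p q where X: "\<And>n. E (basis_X n) = (Poly_Mapping.single n (p n), Poly_Mapping.single n (q n))"
    by metis
  note eqs = Der_coordinates[OF E_Der L X]
  have "fst (br w (basis_L 1)) = Poly_Mapping.single 1 s"
    by (simp add: w_def br_Pair witt_bracket_def)
  then have "Poly_Mapping.lookup (fst (E (basis_L 1))) 1 = 0"
    by (simp add: E_def lookup_minus s_def)
  then have "\<alpha> 1 = 0" by (simp add: L)
  moreover have "\<alpha> (k + l) = \<alpha> k + \<alpha> l" if "k \<noteq> l" for k l
    using eqs(1)[of l k] that by simp
  ultimately have \<alpha>: "\<alpha> n = 0" for n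
    using additive_off_diagonal[of \<alpha>] by blast
  have p: "p n = 0" for n
    using eqs(3) by (rule no_weighted_hom_to_adjoint)
  define a where "a = q 1"
  have q: "q n = a" for n
    unfolding a_def by (rule weighted_endomorphism_constant) (simp add: eqs(4) \<alpha>)
  have "E = outer a f"
    by (rule linear_eq_on_basis[OF Der_linear[OF E_Der] outer_linear])
      (simp_all add: L X \<alpha> p q outer_basis)
  then have "D - outer a f = br z + br w"
    unfolding E_def by (metis (no_types) add.commute add_diff_cancel_left' diff_add_cancel diff_diff_eq)
  also have "\<dots> = br (z + w)"
    by (rule ext) (simp only: plus_fun_def bracket_add_left)
  finally have "D - outer a f \<in> Inn" unfolding Inn_def by blast
  then show thesis using that eqs(2) by blast
qed

text \<open>If \<open>ad z\<close> has the normal form, then its value at \<open>L\<^sub>0\<close> shows that \<open>z\<close> is concentrated in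
  degree \<open>0\<close>, and its value at \<open>L\<^sub>1\<close> that \<open>z\<close> does not involve \<open>L\<^sub>0\<close>. So \<open>z\<close> is a multiple of
  \<open>X\<^sub>0\<close>, and \<open>[X\<^sub>0, L\<^sub>n] = - c n 0 X\<^sub>n\<close>.\<close>

lemma outer_in_Inn_iff:
  "outer a f \<in> Inn \<longleftrightarrow> a = 0 \<and> (\<exists>y. \<forall>n. f n = y * c n 0)"
proof
  assume "outer a f \<in> Inn"
  then obtain z' where z': "outer a f = br z'"
    unfolding Inn_def by blast
  obtain z1 z2 where "z' = (z1, z2)" by (cases z')
  then have z: "outer a f = br (z1, z2)" using z' by simp
  have "br (z1, z2) (basis_L 0) = (0, Poly_Mapping.single 0 (f 0))"
    using outer_basis(1)[of a f 0] unfolding z by simp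
  then have e: "diagonal_ext (\<lambda>j. - of_int j) z1 = 0"
      "diagonal_ext (\<lambda>j. - of_int j) z2 = Poly_Mapping.single 0 (f 0)"
    by (simp_all add: bracket_basis_L0)
  have "Poly_Mapping.lookup z1 k = 0" "Poly_Mapping.lookup z2 k = 0" if "k \<noteq> 0" for k
    using that arg_cong[OF e(1), of "\<lambda>f. Poly_Mapping.lookup f k"]
      arg_cong[OF e(2), of "\<lambda>f. Poly_Mapping.lookup f k"]
    by (auto simp: lookup_single)
  then obtain s t where st: "z1 = Poly_Mapping.single 0 s" "z2 = Poly_Mapping.single 0 t"
    using eq_single_if_supported[of 0 z1] eq_single_if_supported[of 0 z2] by metis
  have "br (z1, z2) (basis_L 1) = (0, Poly_Mapping.single 1 (f 1))"
    using outer_basis(1)[of a f 1] unfolding z .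
  from arg_cong[OF this, of "\<lambda>v. Poly_Mapping.lookup (fst v) 1"] have s: "s = 0"
    by (simp add: st br_Pair witt_bracket_def)
  have "br (z1, z2) (basis_X 0) = (0, Poly_Mapping.single 0 a)"
    using outer_basis(2)[of a f 0] unfolding z .
  from arg_cong[OF this, of "\<lambda>v. Poly_Mapping.lookup (snd v) 0"] have a: "a = 0"
    by (simp add: st s br_Pair)
  have "f n = - t * c n 0" for n
  proof -
    have "br (z1, z2) (basis_L n) = (0, Poly_Mapping.single n (f n))"
      using outer_basis(1)[of a f n] unfolding z .
    from arg_cong[OF this, of "\<lambda>v. Poly_Mapping.lookup (snd v) n"] show ?thesis
      by (simp add: st s br_Pair lookup_minus)
  qed
  then show "a = 0 \<and> (\<exists>y. \<forall>n. f n = y * c n 0)" using a by blast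
next
  assume "a = 0 \<and> (\<exists>y. \<forall>n. f n = y * c n 0)"
  then obtain y where a: "a = 0" and y: "\<And>n. f n = y * c n 0" by blast
  have "outer a f = br (0, Poly_Mapping.single 0 (- y))"
  proof (rule linear_eq_on_basis[OF outer_linear])
    have "br (0, Poly_Mapping.single 0 (- y)) \<in> Der" using Inn_subset_Der unfolding Inn_def by blast
    then show "Vector_Spaces.linear wscale wscale (br (0, Poly_Mapping.single 0 (- y)))"
      by (rule Der_linear)
  qed (simp_all add: outer_basis a y br_Pair flip: single_uminus)
  then show "outer a f \<in> Inn" unfolding Inn_def by blast
qed

definition combination :: "complex list \<Rightarrow> (int \<Rightarrow> complex) list \<Rightarrow> int \<Rightarrow> complex" where
  "combination ks fs n = sum_list (map2 (\<lambda>k f. k * f n) ks fs)"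

lemma outer_add: "outer a f + outer b g = outer (a + b) (\<lambda>n. f n + g n)"
  by (rule ext) (auto simp: outer_def pm_scale_linear split: prod.split
      intro!: poly_mapping_eqI simp: lookup_add algebra_simps)

lemma outer_scale: "fun_scale wscale k (outer a f) = outer (k * a) (\<lambda>n. k * f n)"
  by (rule ext) (auto simp: fun_scale_def outer_def pm_scale_linear split: prod.split
      intro!: poly_mapping_eqI simp: lookup_add algebra_simps)

lemma outer_0: "outer 0 (\<lambda>n. 0) = 0"
  by (rule ext) (auto simp: outer_def zero_prod_def intro!: poly_mapping_eqI)

lemma sum_list_outer:
  assumes "length ks = length fs"
  shows "sum_list (map2 (fun_scale wscale) (k # ks) (outer 1 (\<lambda>_. 0) # map (outer 0) fs)) =
    outer k (combination ks fs)"
proof -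
  have "sum_list (map2 (fun_scale wscale) ks (map (outer 0) fs)) = outer 0 (combination ks fs)"
    using assms
  proof (induction fs arbitrary: ks)
    case Nil
    then show ?case by (simp add: combination_def outer_0)
  next
    case (Cons f fs)
    then obtain l ls where ks: "ks = l # ls" "length ls = length fs" by (cases ks) auto
    have "combination (l # ls) (f # fs) = (\<lambda>n. l * f n + combination ls fs n)"
      by (simp add: combination_def fun_eq_iff)
    then show ?case using Cons.IH[OF ks(2)] by (simp add: ks(1) outer_scale outer_add)
  qed
  then show ?thesis by (simp add: outer_scale outer_add)
qed

text \<open>This reduces the theorem to solving \<open>cocycle f\<close> modulo the multiples of \<open>n \<mapsto> c n 0\<close>, the
  cocycle of the inner derivations that preserve degrees.\<close>

proposition relative_basis_Der_Inn:
  assumes coc: "\<And>f. f \<in> set fs \<Longrightarrow> cocycle f"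
    and span: "\<And>f. cocycle f \<Longrightarrow>
      \<exists>y ks. length ks = length fs \<and> (\<forall>n. f n = y * c n 0 + combination ks fs n)"
    and indep: "\<And>ks y. length ks = length fs \<Longrightarrow> (\<forall>n. combination ks fs n = y * c n 0) \<Longrightarrow>
      ks = replicate (length fs) 0"
  shows "endo.relative_basis Der Inn (outer 1 (\<lambda>_. 0) # map (outer 0) fs)"
  unfolding endo.relative_basis_def
proof (intro conjI ballI allI impI)
  show "endo.subspace Der" "endo.subspace Inn" "Inn \<subseteq> Der"
    by (rule subspace_Der subspace_Inn Inn_subset_Der)+
  have "cocycle (\<lambda>_. 0)" by (simp add: cocycle_def)
  then show "set (outer 1 (\<lambda>_. 0) # map (outer 0) fs) \<subseteq> Der"
    using coc by (auto intro: outer_in_Der)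
next
  fix D assume "D \<in> Der"
  then obtain a f where f: "cocycle f" and D: "D - outer a f \<in> Inn"
    by (rule Der_normal_form)
  obtain y ks where ks: "length ks = length fs" "\<And>n. f n = y * c n 0 + combination ks fs n"
    using span[OF f] by blast
  have "f = (\<lambda>n. y * c n 0 + combination ks fs n)" using ks(2) by (rule ext)
  then have "outer a f = outer 0 (\<lambda>n. y * c n 0) + outer a (combination ks fs)"
    unfolding outer_add by simp
  then have eq: "D - outer a (combination ks fs) = (D - outer a f) + outer 0 (\<lambda>n. y * c n 0)"
    by (simp add: algebra_simps)
  have "outer 0 (\<lambda>n. y * c n 0) \<in> Inn" unfolding outer_in_Inn_iff by blast
  then have "D - outer a (combination ks fs) \<in> Inn"
    unfolding eq using D subspace_Inn by (intro endo.subspace_add)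
  then show "\<exists>cs. length cs = length (outer 1 (\<lambda>_. 0) # map (outer 0) fs) \<and>
      D - sum_list (map2 (fun_scale wscale) cs (outer 1 (\<lambda>_. 0) # map (outer 0) fs)) \<in> Inn"
    using ks(1) by (intro exI[of _ "a # ks"]) (simp add: sum_list_outer del: zip_Cons_Cons)
next
  fix cs assume len: "length cs = length (outer 1 (\<lambda>_. 0) # map (outer 0) fs)"
    and mem: "sum_list (map2 (fun_scale wscale) cs (outer 1 (\<lambda>_. 0) # map (outer 0) fs)) \<in> Inn"
  obtain k ks where cs: "cs = k # ks" "length ks = length fs" using len by (cases cs) auto
  have "outer k (combination ks fs) \<in> Inn"
    using mem unfolding cs(1) sum_list_outer[OF cs(2)] .
  then show "cs = replicate (length (outer 1 (\<lambda>_. 0) # map (outer 0) fs)) 0"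
    using indep[OF cs(2)] unfolding outer_in_Inn_iff cs(1) by auto
qed

end


section \<open>Solving the cocycle equations\<close>

text \<open>Both cocycle equations for \<open>n = 1\<close> express \<open>f (j + 1)\<close> through \<open>f 1\<close> and \<open>f j\<close> with the
  factor \<open>j - 1\<close>, so on the positive integers a solution is determined by its values at \<open>1\<close>
  and \<open>2\<close>.\<close>

lemma vanishes_on_positives:
  fixes h :: "int \<Rightarrow> complex"
  assumes "h 1 = 0" "h 2 = 0"
    and step: "\<And>j. j \<ge> 2 \<Longrightarrow> h j = 0 \<Longrightarrow> of_int (j - 1) * h (j + 1) = 0"
    and "k > 0"
  shows "h k = 0"
proof (cases "k = 1")
  case False
  then have "k \<ge> 2" using \<open>k > 0\<close> by simp
  then show ?thesis
  proof (induction k rule: int_ge_induct)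
    case (step j)
    have "of_int (j - 1) \<noteq> (0 :: complex)"
      using step.hyps by (simp only: of_int_eq_0_iff)
    then show ?case using assms(3)[OF step.hyps step.IH] by (metis mult_eq_0_iff)
  qed (rule assms(2))
qed (simp add: assms(1))

text \<open>The relation with \<open>n = 2\<close> and \<open>m = - 1\<close> carries the vanishing at \<open>1\<close> and \<open>2\<close> over to \<open>- 1\<close>,
  and \<open>n = 1\<close> with \<open>m = - 2\<close> then carries it to \<open>- 2\<close>; the negative integers follow because
  the relation is invariant under \<open>n \<mapsto> - n\<close>.\<close>

lemma A_relation_determined:
  fixes g :: "int \<Rightarrow> complex"
  assumes rel: "\<And>n m. n \<noteq> 0 \<Longrightarrow> m \<noteq> 0 \<Longrightarrow>
      of_int (m - n) * g (n + m) = of_int (n + m) * (g m - g n)"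
    and z: "g 1 = 0" "g 2 = 0" and "n \<noteq> 0"
  shows "g n = 0"
proof -
  have m1: "g (- 1) = 0" using rel[of 2 "- 1"] z by simp
  have m2: "g (- 2) = 0" using rel[of 1 "- 2"] z m1 by simp
  have pos: "g k = 0" if "k > 0" for k
    using z(1,2)
  proof (rule vanishes_on_positives)
    fix j :: int assume "j \<ge> 2" "g j = 0"
    then show "of_int (j - 1) * g (j + 1) = 0"
      using rel[of 1 j] z(1) by (simp add: add.commute)
  qed (rule that)
  have neg: "g (- k) = 0" if "k > 0" for k
    using m1 m2
  proof (rule vanishes_on_positives[of "\<lambda>j. g (- j)"])
    fix j :: int assume j: "j \<ge> 2" "g (- j) = 0"
    have "of_int (- j - - 1) * g (- 1 + - j) = 0"
      using rel[of "- 1" "- j"] j m1 by simp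
    moreover have "- 1 + - j = - (j + 1)" by simp
    moreover have "of_int (- j - - 1) = - (of_int (j - 1) :: complex)" by simp
    ultimately show "of_int (j - 1) * g (- (j + 1)) = 0"
      by (simp only: mult_minus_left neg_equal_0_iff_equal)
  qed (rule that)
  show ?thesis
    using pos[of n] neg[of "- n"] \<open>n \<noteq> 0\<close> by (cases "n > 0") simp_all
qed

lemma B_relation_determined:
  fixes g :: "int \<Rightarrow> complex"
  assumes rel: "\<And>n m. n + m \<noteq> 0 \<Longrightarrow>
      of_int (m - n) * g (n + m) = of_int m * g m - of_int n * g n"
    and z: "g 1 = 0" "g 2 = 0" and "n \<noteq> 0"
  shows "g n = 0"
proof -
  have m1: "g (- 1) = 0" using rel[of 2 "- 1"] z by simp
  have m2: "g (- 2) = 0" using rel[of 1 "- 2"] z m1 by simp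
  have pos: "g k = 0" if "k > 0" for k
    using z(1,2)
  proof (rule vanishes_on_positives)
    fix j :: int assume "j \<ge> 2" "g j = 0"
    then show "of_int (j - 1) * g (j + 1) = 0"
      using rel[of 1 j] z(1) by (simp add: add.commute)
  qed (rule that)
  have neg: "g (- k) = 0" if "k > 0" for k
    using m1 m2
  proof (rule vanishes_on_positives[of "\<lambda>j. g (- j)"])
    fix j :: int assume j: "j \<ge> 2" "g (- j) = 0"
    have "of_int (- j - - 1) * g (- 1 + - j) = 0"
      using rel[of "- 1" "- j"] j m1 by simp
    moreover have "- 1 + - j = - (j + 1)" by simp
    moreover have "of_int (- j - - 1) = - (of_int (j - 1) :: complex)" by simp
    ultimately show "of_int (j - 1) * g (- (j + 1)) = 0"
      by (simp only: mult_minus_left neg_equal_0_iff_equal)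
  qed (rule that)
  show ?thesis
    using pos[of n] neg[of "- n"] \<open>n \<noteq> 0\<close> by (cases "n > 0") simp_all
qed

text \<open>Both \<open>n\<close> and \<open>n\<^sup>2\<close> solve the relation, and the coefficients below are those for which the
  combination agrees with \<open>f\<close> at \<open>1\<close> and \<open>2\<close>.\<close>

lemma A_relation_solutions:
  fixes f :: "int \<Rightarrow> complex"
  assumes f0: "f 0 = 0"
    and rel: "\<And>n m. n \<noteq> 0 \<Longrightarrow> m \<noteq> 0 \<Longrightarrow>
      of_int (m - n) * f (n + m) = of_int (n + m) * (f m - f n)"
  obtains \<beta> \<gamma> where "\<And>n. f n = \<beta> * of_int n + \<gamma> * of_int n ^ 2"
proof
  let ?\<gamma> = "(f 2 - 2 * f 1) / 2"
  let ?\<beta> = "f 1 - ?\<gamma>"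
  let ?g = "\<lambda>n. f n - ?\<beta> * of_int n - ?\<gamma> * of_int n ^ 2"
  have g: "of_int (m - n) * ?g (n + m) = of_int (n + m) * (?g m - ?g n)"
    if "n \<noteq> 0" "m \<noteq> 0" for n m
  proof -
    have "of_int (m - n) * (\<beta> * of_int (n + m) + \<gamma> * of_int (n + m) ^ 2) =
        of_int (n + m) * ((\<beta> * of_int m + \<gamma> * of_int m ^ 2) - (\<beta> * of_int n + \<gamma> * of_int n ^ 2))"
      for \<beta> \<gamma> :: complex
      by (simp add: algebra_simps power2_eq_square)
    from this[of ?\<beta> ?\<gamma>] rel[OF that] show ?thesis
      by (simp only: right_diff_distrib diff_diff_eq) (simp only: algebra_simps)
  qed
  fix n
  have "?g n = 0"
  proof (cases "n = 0")
    case False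
    show ?thesis
      by (rule A_relation_determined[of ?g, OF g _ _ False]) (simp_all add: field_simps)
  qed (simp add: f0)
  then show "f n = ?\<beta> * of_int n + ?\<gamma> * of_int n ^ 2"
    by (simp only: diff_diff_eq right_minus_eq)
qed

text \<open>In the same way, the constants and \<open>n\<close> solve the relation of \<open>B\<close>, but here the value at \<open>0\<close>
  is not constrained: the pairs with \<open>n + m = 0\<close> are left out.\<close>

lemma B_relation_solutions:
  fixes f :: "int \<Rightarrow> complex"
  assumes rel: "\<And>n m. n + m \<noteq> 0 \<Longrightarrow>
      of_int (m - n) * f (n + m) = of_int m * f m - of_int n * f n"
  obtains \<alpha> \<beta> where "\<And>n. n \<noteq> 0 \<Longrightarrow> f n = \<alpha> + \<beta> * of_int n"
proof
  let ?\<beta> = "f 2 - f 1"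
  let ?\<alpha> = "f 1 - ?\<beta>"
  let ?g = "\<lambda>n. f n - ?\<alpha> - ?\<beta> * of_int n"
  have g: "of_int (m - n) * ?g (n + m) = of_int m * ?g m - of_int n * ?g n"
    if "n + m \<noteq> 0" for n m
  proof -
    have "of_int (m - n) * (\<alpha> + \<beta> * of_int (n + m)) =
        of_int m * (\<alpha> + \<beta> * of_int m) - of_int n * (\<alpha> + \<beta> * of_int n)"
      for \<beta> \<alpha> :: complex
      by (simp add: algebra_simps)
    from this[of ?\<alpha> ?\<beta>] rel[OF that] show ?thesis
      by (simp only: right_diff_distrib diff_diff_eq) (simp only: algebra_simps)
  qed
  fix n :: int assume n: "n \<noteq> 0"
  have "?g n = 0"
    by (rule B_relation_determined[of ?g, OF g _ _ n]) (simp_all add: field_simps)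
  then show "f n = ?\<alpha> + ?\<beta> * of_int n" by (simp add: algebra_simps)
qed

section \<open>Derivations of the extensions by A and B\<close>

lemma lam_term_0 [simp]: "lam_term lam 0 = 0"
  by (cases lam) auto

definition coeff_A :: "proj_line \<Rightarrow> int \<Rightarrow> int \<Rightarrow> complex" where
  "coeff_A lam n m = of_int (n + m) + lam_term lam n * of_bool (m = 0)"

definition coeff_B :: "proj_line \<Rightarrow> int \<Rightarrow> int \<Rightarrow> complex" where
  "coeff_B lam n m = of_int m - lam_term lam n * of_bool (n + m = 0)"

lemma coeff_A_0_nonzero: "\<exists>n. n \<noteq> 0 \<and> coeff_A lam n 0 \<noteq> 0"
proof (cases lam)
  case (Finite l)
  then show ?thesis by (intro exI[of _ "- 1"]) (simp add: coeff_A_def)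
next
  case Infinity
  then show ?thesis by (intro exI[of _ 1]) (simp add: coeff_A_def)
qed

interpretation A: witt_extension "coeff_A lam"
  rewrites "witt_extension.br (coeff_A lam) = WA_bracket lam" for lam
proof -
  show "witt_extension (coeff_A lam)"
  proof (rule witt_extension.intro)
    have "bilinear_ext (coeff_A lam) = act_A lam"
      by (simp add: coeff_A_def[abs_def] act_A_def)
    then show "lie_module pm_scale witt_bracket pm_scale (bilinear_ext (coeff_A lam))"
      using lie_module_act_A by simp
    show "m \<noteq> 0 \<Longrightarrow> n + m \<noteq> 0 \<Longrightarrow> coeff_A lam n m \<noteq> 0" for n m
      by (simp add: coeff_A_def del: of_int_add)
  qed (use coeff_A_0_nonzero in \<open>auto simp: coeff_A_def\<close>)
  then show "witt_extension.br (coeff_A lam) = WA_bracket lam"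
    by (simp add: witt_extension.br_def WA_bracket_def act_A_def coeff_A_def[abs_def])
qed

interpretation B: witt_extension "coeff_B lam"
  rewrites "witt_extension.br (coeff_B lam) = WB_bracket lam" for lam
proof -
  show "witt_extension (coeff_B lam)"
  proof (rule witt_extension.intro)
    have "bilinear_ext (coeff_B lam) = act_B lam"
      by (simp add: coeff_B_def[abs_def] act_B_def)
    then show "lie_module pm_scale witt_bracket pm_scale (bilinear_ext (coeff_B lam))"
      using lie_module_act_B by simp
    show "m \<noteq> 0 \<Longrightarrow> n + m \<noteq> 0 \<Longrightarrow> coeff_B lam n m \<noteq> 0" for n m
      by (simp add: coeff_B_def)
    show "\<exists>n. n \<noteq> 0 \<and> (coeff_B lam n 0 \<noteq> 0 \<or> coeff_B lam n (- n) \<noteq> 0)"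
    proof (cases lam)
      case (Finite l)
      then show ?thesis by (intro exI[of _ "- 1"]) (simp add: coeff_B_def)
    next
      case Infinity
      then show ?thesis by (intro exI[of _ 1]) (simp add: coeff_B_def)
    qed
  qed (auto simp: coeff_B_def)
  then show "witt_extension.br (coeff_B lam) = WB_bracket lam"
    by (simp add: witt_extension.br_def WB_bracket_def act_B_def coeff_B_def[abs_def])
qed

definition outer_cocycle_A :: "proj_line \<Rightarrow> int \<Rightarrow> complex" where
  "outer_cocycle_A lam n = (if lam = Finite 0 then of_int (n * (n + 1)) else of_int n)"

definition outer_cocycle_B :: "proj_line \<Rightarrow> int \<Rightarrow> complex" where
  "outer_cocycle_B lam n =
     (case lam of Finite l \<Rightarrow> if n = 0 then l + 1 else 1 | Infinity \<Rightarrow> 1)"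

text \<open>The pairs with \<open>m = 0\<close> only say \<open>f 0 = 0\<close>, so the special coefficients \<open>c n 0\<close>, and with
  them \<open>\<lambda>\<close>, disappear from the cocycle condition. They come back in the coboundary \<open>c n 0\<close>.\<close>

lemma cocycle_A_iff:
  "A.cocycle lam f \<longleftrightarrow> f 0 = 0 \<and> (\<forall>n m. n \<noteq> 0 \<longrightarrow> m \<noteq> 0 \<longrightarrow>
     of_int (m - n) * f (n + m) = of_int (n + m) * (f m - f n))"
proof
  assume coc: "A.cocycle lam f"
  obtain n where n: "coeff_A lam n 0 \<noteq> 0" using coeff_A_0_nonzero by blast
  have "coeff_A lam n 0 * f 0 = 0"
    using coc[unfolded A.cocycle_def, rule_format, of 0 n] by (auto simp: coeff_A_def split: if_splits)
  then have "f 0 = 0" using n by simp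
  moreover have "of_int (m - n) * f (n + m) = of_int (n + m) * (f m - f n)"
    if "n \<noteq> 0" "m \<noteq> 0" for n m
    using coc[unfolded A.cocycle_def, rule_format, of m n] that
    by (simp add: coeff_A_def algebra_simps)
  ultimately show "f 0 = 0 \<and> (\<forall>n m. n \<noteq> 0 \<longrightarrow> m \<noteq> 0 \<longrightarrow>
     of_int (m - n) * f (n + m) = of_int (n + m) * (f m - f n))" by blast
next
  assume f: "f 0 = 0 \<and> (\<forall>n m. n \<noteq> 0 \<longrightarrow> m \<noteq> 0 \<longrightarrow>
     of_int (m - n) * f (n + m) = of_int (n + m) * (f m - f n))"
  show "A.cocycle lam f"
    unfolding A.cocycle_def
  proof (intro allI)
    fix n m :: int
    consider "n = 0" | "m = 0" | "n \<noteq> 0" "m \<noteq> 0" by blast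
    then show "of_int (m - n) * f (n + m) = coeff_A lam n m * f m - coeff_A lam m n * f n"
    proof cases
      case 3
      then have "of_int (m - n) * f (n + m) = of_int (n + m) * (f m - f n)"
        using f by blast
      then show ?thesis using 3 by (simp add: coeff_A_def algebra_simps)
    qed (use f in \<open>simp_all add: coeff_A_def\<close>)
  qed
qed

text \<open>The cocycles are spanned by \<open>n\<close> and \<open>n\<^sup>2\<close>, and the coboundaries by \<open>n + n (n + 1) \<lambda>\<close>, or
  \<open>n + n\<^sup>2\<close> at infinity. For \<open>\<lambda> \<noteq> 0\<close> the latter involves \<open>n\<^sup>2\<close>, so \<open>n\<close> represents the
  quotient; for \<open>\<lambda> = 0\<close> it is \<open>n\<close> itself, and \<open>n (n + 1)\<close> does.\<close>

lemma relative_basis_A: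
  "endo.relative_basis (WA.Der lam) (WA.Inn lam) [d_Ab, d_A lam]"
proof -
  have "endo.relative_basis (WA.Der lam) (WA.Inn lam)
      (A.outer 1 (\<lambda>_. 0) # map (A.outer 0) [outer_cocycle_A lam])"
  proof (rule A.relative_basis_Der_Inn)
    show "A.cocycle lam f" if "f \<in> set [outer_cocycle_A lam]" for f
      using that by (auto simp: cocycle_A_iff outer_cocycle_A_def algebra_simps)
  next
    fix f assume "A.cocycle lam f"
    then obtain \<beta> \<gamma> where f: "\<And>n. f n = \<beta> * of_int n + \<gamma> * of_int n ^ 2"
      unfolding cocycle_A_iff using A_relation_solutions[of f] by metis
    show "\<exists>y ks. length ks = length [outer_cocycle_A lam] \<and>
        (\<forall>n. f n = y * coeff_A lam n 0 + A.combination ks [outer_cocycle_A lam] n)"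
    proof (cases lam)
      case (Finite l)
      show ?thesis
      proof (cases "l = 0")
        case True
        show ?thesis
          by (rule exI[of _ "\<beta> - \<gamma>"], rule exI[of _ "[\<gamma>]"])
            (simp add: Finite True f coeff_A_def A.combination_def outer_cocycle_A_def
              algebra_simps power2_eq_square)
      next
        case False
        show ?thesis
          by (rule exI[of _ "\<gamma> / l"], rule exI[of _ "[\<beta> - \<gamma> * (1 + l) / l]"])
            (simp add: Finite False f coeff_A_def A.combination_def outer_cocycle_A_def
              field_simps power2_eq_square)
      qed
    next
      case Infinity
      show ?thesis
        by (rule exI[of _ "\<gamma>"], rule exI[of _ "[\<beta> - \<gamma>]"])
          (simp add: Infinity f coeff_A_def A.combination_def outer_cocycle_A_def
            algebra_simps power2_eq_square)
    qed
  next
    fix ks y assume "length ks = length [outer_cocycle_A lam]"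
      and eq: "\<forall>n. A.combination ks [outer_cocycle_A lam] n = y * coeff_A lam n 0"
    then obtain k where ks: "ks = [k]" by (auto simp: length_Suc_conv)
    have "k * outer_cocycle_A lam n = y * coeff_A lam n 0" for n
      using eq by (simp add: ks A.combination_def)
    \<comment> \<open>The coefficient \<open>n (n + 1)\<close> of \<open>\<lambda>\<close> vanishes at \<open>- 1\<close>, but not at \<open>1\<close>.\<close>
    from this[of "- 1"] this[of 1] have "k = 0"
      by (cases lam) (auto simp: outer_cocycle_A_def coeff_A_def algebra_simps split: if_splits)
    then show "ks = replicate (length [outer_cocycle_A lam]) 0" by (simp add: ks)
  qed
  moreover have "A.outer 1 (\<lambda>_. 0) = d_Ab"
    by (rule ext) (auto simp: A.outer_def d_Ab_def pm_scale_linear intro!: poly_mapping_eqI simp: lookup_add)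
  moreover have "A.outer 0 (outer_cocycle_A lam) = d_A lam"
    by (rule ext) (auto simp: A.outer_def d_A_def pm_scale_linear outer_cocycle_A_def[abs_def])
  ultimately show ?thesis by simp
qed

text \<open>In \<open>B(\<lambda>)\<close> the vector \<open>B\<^sub>0\<close> is invariant, so the
  coboundaries that preserve degrees vanish.\<close>

lemma coeff_B_0: "coeff_B lam n 0 = 0"
  by (cases "n = 0") (simp_all add: coeff_B_def)

lemma cocycle_outer_cocycle_B: "B.cocycle lam (outer_cocycle_B lam)"
  unfolding B.cocycle_def
proof (intro allI)
  fix n m :: int
  consider "n = 0" | "m = 0" | "n \<noteq> 0" "m = - n" | "n \<noteq> 0" "m \<noteq> 0" "n + m \<noteq> 0" by linarith
  then show "of_int (m - n) * outer_cocycle_B lam (n + m) =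
      coeff_B lam n m * outer_cocycle_B lam m - coeff_B lam m n * outer_cocycle_B lam n"
    by cases (cases lam; simp add: outer_cocycle_B_def coeff_B_def add.commute algebra_simps power2_eq_square)+
qed

text \<open>Away from \<open>n + m = 0\<close> a cocycle is \<open>\<alpha> + \<beta> n\<close> for \<open>n \<noteq> 0\<close>. The pairs \<open>(1, -1)\<close> and
  \<open>(2, -2)\<close> give two formulas for \<open>f 0\<close>, whose difference is a nonzero multiple of \<open>\<lambda> \<beta>\<close>
  (of \<open>\<beta>\<close> at infinity). So \<open>n \<mapsto> n\<close> is a cocycle only for \<open>\<lambda> = 0\<close>, which is where
  \<open>del_B\<close> comes from.\<close>

lemma cocycle_B_normal_form:
  assumes coc: "B.cocycle lam f"
  obtains \<alpha> \<beta> where "\<And>n. f n = \<alpha> * outer_cocycle_B lam n + \<beta> * of_int n"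
    "lam \<noteq> Finite 0 \<Longrightarrow> \<beta> = 0"
proof -
  note eq = coc[unfolded B.cocycle_def, rule_format]
  have rel: "of_int (m - n) * f (n + m) = of_int m * f m - of_int n * f n" if "n + m \<noteq> 0" for n m
    using eq[of m n] that by (simp add: coeff_B_def add.commute)
  obtain \<alpha> \<beta> where f: "\<And>n. n \<noteq> 0 \<Longrightarrow> f n = \<alpha> + \<beta> * of_int n"
    using B_relation_solutions[of f, OF rel] by metis
  have e1: "- 2 * f 0 = coeff_B lam 1 (- 1) * (\<alpha> - \<beta>) - coeff_B lam (- 1) 1 * (\<alpha> + \<beta>)"
    using eq[of "- 1" 1] by (simp add: f)
  have e2: "- 4 * f 0 = coeff_B lam 2 (- 2) * (\<alpha> - 2 * \<beta>) - coeff_B lam (- 2) 2 * (\<alpha> + 2 * \<beta>)"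
    using eq[of "- 2" 2] by (simp add: f mult.commute)
  have "f 0 = \<alpha> * outer_cocycle_B lam 0 \<and> (lam \<noteq> Finite 0 \<longrightarrow> \<beta> = 0)"
  proof (cases lam)
    case (Finite l)
    have "2 * f 0 = 2 * (\<alpha> + l * \<alpha> - l * \<beta>)"
      using e1 by (simp add: Finite coeff_B_def algebra_simps)
    then have f0: "f 0 = \<alpha> + l * \<alpha> - l * \<beta>"
      by (simp only: mult_cancel_left) simp
    have "4 * f 0 = 4 * \<alpha> + 4 * l * \<alpha> - 16 * l * \<beta>"
      using e2 by (simp add: Finite coeff_B_def algebra_simps)
    then have "16 * (l * \<beta>) - 4 * (l * \<beta>) = 0"
      unfolding f0 by (simp only: algebra_simps add_left_cancel) (simp add: algebra_simps)
    then have l\<beta>: "l * \<beta> = 0" by auto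
    show ?thesis
      unfolding f0 l\<beta> using l\<beta> by (auto simp: Finite outer_cocycle_B_def algebra_simps)
  next
    case Infinity
    have "2 * f 0 = 2 * (\<alpha> - \<beta>)"
      using e1 by (simp add: Infinity coeff_B_def algebra_simps)
    then have f0: "f 0 = \<alpha> - \<beta>"
      by (simp only: mult_cancel_left) simp
    have "4 * f 0 = 4 * \<alpha> - 16 * \<beta>"
      using e2 by (simp add: Infinity coeff_B_def algebra_simps)
    then have "16 * \<beta> - 4 * \<beta> = 0"
      unfolding f0 by (simp only: algebra_simps add_left_cancel) (simp add: algebra_simps)
    then have "\<beta> = 0" by auto
    then show ?thesis
      using f0 by (simp add: Infinity outer_cocycle_B_def)
  qed
  moreover have "outer_cocycle_B lam n = 1" if "n \<noteq> 0" for n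
    using that by (cases lam) (auto simp: outer_cocycle_B_def)
  ultimately have "f n = \<alpha> * outer_cocycle_B lam n + \<beta> * of_int n" for n
    using f by (cases "n = 0") auto
  then show thesis using that \<open>f 0 = _ \<and> _\<close> by blast
qed

lemma d_Ab_B: "B.outer 1 (\<lambda>_. 0) = d_Ab"
  by (rule ext) (auto simp: B.outer_def d_Ab_def pm_scale_linear intro!: poly_mapping_eqI simp: lookup_add)

lemma d_B_outer: "B.outer 0 (outer_cocycle_B lam) = d_B lam"
  by (rule ext) (auto simp: B.outer_def d_B_def pm_scale_linear outer_cocycle_B_def[abs_def])

lemma del_B_outer: "B.outer 0 of_int = del_B"
  by (rule ext) (auto simp: B.outer_def del_B_def pm_scale_linear)

lemma relative_basis_B:
  assumes lam: "lam \<noteq> Finite 0"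
  shows "endo.relative_basis (WB.Der lam) (WB.Inn lam) [d_Ab, d_B lam]"
proof -
  have "endo.relative_basis (WB.Der lam) (WB.Inn lam)
      (B.outer 1 (\<lambda>_. 0) # map (B.outer 0) [outer_cocycle_B lam])"
  proof (rule B.relative_basis_Der_Inn)
    show "B.cocycle lam f" if "f \<in> set [outer_cocycle_B lam]" for f
      using that cocycle_outer_cocycle_B by simp
  next
    fix f assume "B.cocycle lam f"
    then obtain \<alpha> where f: "\<And>n. f n = \<alpha> * outer_cocycle_B lam n"
      by (rule cocycle_B_normal_form) (use lam in auto)
    show "\<exists>y ks. length ks = length [outer_cocycle_B lam] \<and>
        (\<forall>n. f n = y * coeff_B lam n 0 + B.combination ks [outer_cocycle_B lam] n)"
      by (intro exI[of _ 0] exI[of _ "[\<alpha>]"]) (simp add: f B.combination_def)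
  next
    fix ks y assume "length ks = length [outer_cocycle_B lam]"
      and eq: "\<forall>n. B.combination ks [outer_cocycle_B lam] n = y * coeff_B lam n 0"
    then obtain k where ks: "ks = [k]" by (auto simp: length_Suc_conv)
    have "k = 0"
      using eq[rule_format, of 1]
      by (cases lam) (simp_all add: ks B.combination_def coeff_B_0 outer_cocycle_B_def)
    then show "ks = replicate (length [outer_cocycle_B lam]) 0" by (simp add: ks)
  qed
  then show ?thesis by (simp add: d_Ab_B d_B_outer)
qed

lemma relative_basis_B0:
  "endo.relative_basis (WB.Der (Finite 0)) (WB.Inn (Finite 0)) [d_Ab, d_B (Finite 0), del_B]"
proof -
  let ?fs = "[outer_cocycle_B (Finite 0), of_int]"
  have one: "outer_cocycle_B (Finite 0) n = 1" for n
    by (simp add: outer_cocycle_B_def)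
  have "endo.relative_basis (WB.Der (Finite 0)) (WB.Inn (Finite 0))
      (B.outer 1 (\<lambda>_. 0) # map (B.outer 0) ?fs)"
  proof (rule B.relative_basis_Der_Inn)
    show "B.cocycle (Finite 0) f" if "f \<in> set ?fs" for f
    proof -
      have "B.cocycle (Finite 0) of_int"
        by (simp add: B.cocycle_def coeff_B_def algebra_simps)
      then show ?thesis using that cocycle_outer_cocycle_B[of "Finite 0"] by auto
    qed
  next
    fix f assume "B.cocycle (Finite 0) f"
    then obtain \<alpha> \<beta> where f: "\<And>n. f n = \<alpha> * outer_cocycle_B (Finite 0) n + \<beta> * of_int n"
      by (rule cocycle_B_normal_form) auto
    show "\<exists>y ks. length ks = length ?fs \<and>
        (\<forall>n. f n = y * coeff_B (Finite 0) n 0 + B.combination ks ?fs n)"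
      by (intro exI[of _ 0] exI[of _ "[\<alpha>, \<beta>]"]) (simp add: f B.combination_def)
  next
    fix ks y assume "length ks = length ?fs"
      and eq: "\<forall>n. B.combination ks ?fs n = y * coeff_B (Finite 0) n 0"
    then obtain k l where ks: "ks = [k, l]" by (auto simp: length_Suc_conv)
    have "k = 0" "k + l = 0"
      using eq[rule_format, of 0] eq[rule_format, of 1]
      by (simp_all add: ks B.combination_def coeff_B_0 one)
    then show "ks = replicate (length ?fs) 0" by (simp add: ks)
  qed
  then show ?thesis by (simp add: d_Ab_B d_B_outer del_B_outer)
qed

theorem theorem1p3:
  fixes lam :: proj_line
  shows "is_direct_sum (fun_scale wscale) (WA.Der lam)
           [WA.Inn lam, line (fun_scale wscale) d_Ab, line (fun_scale wscale) (d_A lam)]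
       \<and> (if lam = Finite 0
          then is_direct_sum (fun_scale wscale) (WB.Der lam)
                 [WB.Inn lam, line (fun_scale wscale) d_Ab,
                  line (fun_scale wscale) (d_B lam), line (fun_scale wscale) del_B]
          else is_direct_sum (fun_scale wscale) (WB.Der lam)
                 [WB.Inn lam, line (fun_scale wscale) d_Ab, line (fun_scale wscale) (d_B lam)])
       \<and> has_dimension (WA.H1 lam) 2
       \<and> has_dimension (WB.H1 lam) (if lam = Finite 0 then 3 else 2)"
proof -
  have H1_A: "WA.H1 lam = quotient_space (fun_scale wscale) (WA.Der lam) (WA.Inn lam)"
    by (simp only: WA.H1_def WA.cocycles_eq_Der WA.coboundaries_eq_Inn)
  have H1_B: "WB.H1 lam = quotient_space (fun_scale wscale) (WB.Der lam) (WB.Inn lam)"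
    by (simp only: WB.H1_def WB.cocycles_eq_Der WB.coboundaries_eq_Inn)
  note sum = endo.relative_basis_direct_sum and dim = endo.relative_basis_dimension
  show ?thesis
    unfolding H1_A H1_B
    using sum[OF relative_basis_A[of lam]] dim[OF relative_basis_A[of lam]]
      sum[OF relative_basis_B[of lam]] dim[OF relative_basis_B[of lam]]
      sum[OF relative_basis_B0] dim[OF relative_basis_B0]
    by (auto simp: numeral_2_eq_2 numeral_3_eq_3)
qed

end
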